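(* Let $P$ be a simple $d$-polytope with $m$ facets and at least $n$ vertices, let $p \in [0,1]$ and $q = 1-p$, and let $Q \sim \mathcal{B}(P,p)$. Then the expected number of facets of $Q$ is at least \[p^d m + n q p^d.\] Moreover, for every $\epsilon > 0$, the probability that the number of facets of $Q$ is at least $(1-\epsilon)(p^d m + n q p^d)$ is at least \[1 - e^{-2(\epsilon q p^d/d)^2 n} - e^{-m p^d \epsilon^2/2}.\]
   Context: $\mathcal{B}(P,p)$: include each vertex of $P$ independently with probability $p$ and let $Q$ be the convex hull of the included vertices.
   Formalization: The theorem assumes d ≥ 2: for a segment (d = 1, m = n = 2, 0 < p < 1) the claimed bound 2p + 2pq exceeds the true expectation, which is at most 2p; for a point (d = 0) it fails too. Facets of Q are its faces of codimension one in its own affine hull. *)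

theory Defs
  imports "HOL-Analysis.Analysis" "HOL-Probability.Probability" "HOL-Probability.Product_PMF"
begin

definition vertices :: "'a::euclidean_space set \<Rightarrow> 'a set" where
  "vertices P = {v. v extreme_point_of P}"

text \<open>Facets are taken relative to the polytope's own affine hull (faces of codimension one in the
  polytope), also when the polytope is not full-dimensional; the empty face is never a facet.\<close>

definition facets :: "'a::euclidean_space set \<Rightarrow> 'a set set" where
  "facets P = {F. F facet_of P}"

definition d_polytope :: "nat \<Rightarrow> 'a::euclidean_space set \<Rightarrow> bool" where
  "d_polytope d P \<longleftrightarrow> polytope P \<and> aff_dim P = int d"

definition simple_d_polytope :: "nat \<Rightarrow> 'a::euclidean_space set \<Rightarrow> bool" where
  "simple_d_polytope d P \<longleftrightarrow>
     d_polytope d P \<and> (\<forall>v \<in> vertices P. card {F \<in> facets P. v \<in> F} = d)"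

definition random_subset :: "'a set \<Rightarrow> real \<Rightarrow> 'a set pmf" where
  "random_subset V p = map_pmf (\<lambda>b. {v \<in> V. b v}) (Pi_pmf V False (\<lambda>_. bernoulli_pmf p))"

definition random_subpolytope :: "'a::euclidean_space set \<Rightarrow> real \<Rightarrow> 'a set pmf" where
  "random_subpolytope P p = map_pmf (\<lambda>S. convex hull S) (random_subset (vertices P) p)"

end

theory Submission
  imports Defs
begin

text \<open>
  At a vertex \<open>v\<close> of a simple \<open>d\<close>-polytope the \<open>d\<close> facet normals are a basis, whose dual basis spans the \<open>d\<close>
  edges at \<open>v\<close>; hence the \<open>d\<close> neighbours of \<open>v\<close> span a hyperplane that strictly separates \<open>v\<close> from all
  other vertices, and each facet through \<open>v\<close> contains \<open>v\<close> and \<open>d - 1\<close> of its neighbours (a star). Let \<open>S\<close> be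
  the set of included vertices. A facet of \<open>P\<close> containing a star inside \<open>S\<close>, and a vertex outside \<open>S\<close> all
  of whose neighbours are in \<open>S\<close>, each give a facet of \<open>Q\<close>. So the number of facets of \<open>Q\<close> is at least
  \[ f(S) = \sum_v \Big( \sum_{F \ni v} w_F [\mathrm{star}(v,F) \subseteq S] + [v \notin S, N(v) \subseteq S] \Big), \]
  where \<open>w_F\<close> is the reciprocal of the number of vertices of \<open>F\<close>. Its expectation is exactly
  \<open>p^d m + N q p^d\<close>, where \<open>N\<close> is the number of vertices. Changing the status of a vertex \<open>x\<close> changes \<open>f\<close> by
  at most \<open>d + e_x\<close>, where \<open>e_x\<close> is the sum of the \<open>w_F\<close> over the facets through \<open>x\<close>. Here \<open>e_x \<le> 1\<close>, and
  the \<open>e_x\<close> sum to \<open>m\<close>, so the squared differences sum to at most \<open>N d^2 + (2 d + 1) m\<close> and McDiarmid's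
  inequality gives the tail bound.
\<close>

section \<open>Facets of polytopes\<close>

text \<open>In a minimal description of \<open>P\<close> by halfspaces each facet comes from exactly
  one halfspace, so normals can be indexed by facets. Choosing the halfspaces parallel to the affine
  hull puts the normals into its direction space, which matters when \<open>P\<close> is not
  full-dimensional.\<close>

lemma polyhedron_facet_normals:
  fixes P :: "'a::euclidean_space set"
  assumes "polyhedron P" "P \<noteq> {}"
  obtains a :: "'a set \<Rightarrow> 'a" and b :: "'a set \<Rightarrow> real"
  where "\<And>F x. F facet_of P \<Longrightarrow> x \<in> P \<Longrightarrow> a F \<bullet> x \<le> b F"
    and "\<And>F. F facet_of P \<Longrightarrow> F = P \<inter> {x. a F \<bullet> x = b F}"
    and "\<And>F x. F facet_of P \<Longrightarrow> x \<in> affine hull P \<Longrightarrow> x + a F \<in> affine hull P"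
    and "\<And>x. x \<in> affine hull P \<Longrightarrow> (\<And>F. F facet_of P \<Longrightarrow> a F \<bullet> x \<le> b F) \<Longrightarrow> x \<in> P"
proof -
  obtain H where *: "finite H \<and> P = affine hull P \<inter> \<Inter>H \<and>
      (\<forall>h \<in> H. \<exists>a b. a \<noteq> 0 \<and> h = {x. a \<bullet> x \<le> b} \<and> (\<forall>x \<in> affine hull P. x + a \<in> affine hull P)) \<and>
      (\<forall>H'. H' \<subset> H \<longrightarrow> P \<subset> affine hull P \<inter> \<Inter>H')"
    using assms(1) unfolding polyhedron_Int_affine_parallel_minimal by (rule exE)
  note H = conjunct1[OF *] and seq = conjunct1[OF conjunct2[OF *]]
    and par = conjunct1[OF conjunct2[OF conjunct2[OF *]]]
    and psub = conjunct2[OF conjunct2[OF conjunct2[OF *]], rule_format]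
  obtain a where "\<forall>h\<in>H. \<exists>b. a h \<noteq> 0 \<and> h = {x. a h \<bullet> x \<le> b} \<and> (\<forall>x \<in> affine hull P. x + a h \<in> affine hull P)"
    using bchoice[OF par] by (rule exE)
  from bchoice[OF this] obtain b where b: "\<forall>h\<in>H. a h \<noteq> 0 \<and> h = {x. a h \<bullet> x \<le> b h} \<and>
      (\<forall>x \<in> affine hull P. x + a h \<in> affine hull P)"
    by (rule exE)
  have ab: "a h \<noteq> 0 \<and> h = {x. a h \<bullet> x \<le> b h}" if "h \<in> H" for h
    using bspec[OF b that] by (elim conjE) (rule conjI)
  have para: "x + a h \<in> affine hull P" if "h \<in> H" "x \<in> affine hull P" for h x
    using bspec[OF b that(1)] that(2) by (elim conjE) (rule bspec)
  have memh: "x \<in> h \<longleftrightarrow> a h \<bullet> x \<le> b h" if "h \<in> H" for x h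
    using conjunct2[OF ab[OF that]] by (subst \<open>h = _\<close>) (rule mem_Collect_eq)
  have memP: "x \<in> P \<longleftrightarrow> x \<in> affine hull P \<and> (\<forall>h\<in>H. a h \<bullet> x \<le> b h)" for x
    using memh by (subst seq) auto
  have facet: "C facet_of P \<longleftrightarrow> (\<exists>h. h \<in> H \<and> C = P \<inter> {x. a h \<bullet> x = b h})" for C
    by (rule facet_of_polyhedron_explicit [OF H seq ab psub])
  obtain y where y: "y \<in> rel_interior P"
    using assms polyhedron_imp_convex rel_interior_eq_empty by blast
  have ystrict: "y \<in> P" "\<And>h. h \<in> H \<Longrightarrow> a h \<bullet> y < b h"
    using y rel_interior_polyhedron_explicit [OF H seq ab psub] by auto
  have inj: "h = h'" if h: "h \<in> H" "h' \<in> H" and eq: "P \<inter> {x. a h \<bullet> x = b h} = P \<inter> {x. a h' \<bullet> x = b h'}" for h h'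
  proof (rule ccontr)
    assume "h \<noteq> h'"
    \<comment> \<open>By minimality, dropping \<open>h\<close> admits a point \<open>x\<close> that
      violates \<open>h\<close> alone. The segment from the relative interior point \<open>y\<close>
      to \<open>x\<close> leaves \<open>h\<close> at a point \<open>z\<close> (parameter
      \<open>t\<close>) with slack in every other constraint, so \<open>z\<close> lies on no other
      facet.\<close>
    have "P \<subset> affine hull P \<inter> \<Inter>(H - {h})" using h by (intro psub) auto
    then obtain x where x: "x \<in> affine hull P" "\<And>k. k \<in> H - {h} \<Longrightarrow> x \<in> k" "x \<notin> P" by blast
    have xh: "a h \<bullet> x > b h" using x memh memP[of x] by fastforce
    define t where "t = (b h - a h \<bullet> y) / (a h \<bullet> x - a h \<bullet> y)"
    have yh: "a h \<bullet> y < b h" using ystrict h by auto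
    have t: "0 < t" "t < 1" using xh yh by (auto simp: t_def field_simps)
    define z where "z = (1 - t) *\<^sub>R y + t *\<^sub>R x"
    have zh: "a h \<bullet> z = b h"
    proof -
      have "a h \<bullet> z = a h \<bullet> y + t * (a h \<bullet> x - a h \<bullet> y)"
        by (simp add: z_def inner_add_right algebra_simps)
      also have "\<dots> = b h" using xh yh by (simp add: t_def)
      finally show ?thesis .
    qed
    have zk: "a k \<bullet> z < b k" if k: "k \<in> H - {h}" for k
    proof -
      have "a k \<bullet> x \<le> b k" using x(2)[OF k] memh k by blast
      then have "t * (a k \<bullet> x) \<le> t * b k" using t by simp
      moreover have "(1 - t) * (a k \<bullet> y) < (1 - t) * b k" using ystrict(2)[of k] k t by simp
      ultimately have "(1 - t) * (a k \<bullet> y) + t * (a k \<bullet> x) < (1 - t) * b k + t * b k" by linarith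
      then show ?thesis by (simp add: z_def inner_add_right algebra_simps)
    qed
    have "z \<in> affine hull P"
      unfolding z_def using x(1) ystrict(1) affine_affine_hull[of P] 
      by (metis affine_alt hull_inc)
    moreover have "a k \<bullet> z \<le> b k" if "k \<in> H" for k
      using zk[of k] zh that by (cases "k = h") (auto simp: less_imp_le)
    ultimately have "z \<in> P" using memP by blast
    then have "a h' \<bullet> z = b h'" using zh eq by blast
    then show False using zk[of h'] h \<open>h \<noteq> h'\<close> by auto
  qed
  define g where "g F = (SOME h. h \<in> H \<and> F = P \<inter> {x. a h \<bullet> x = b h})" for F
  have g: "g F \<in> H" "F = P \<inter> {x. a (g F) \<bullet> x = b (g F)}" if "F facet_of P" for F
    using someI_ex[OF that[unfolded facet]] unfolding g_def by auto
  \<comment> \<open>Surjectivity of \<open>g\<close> onto \<open>H\<close>, obtained from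
    injectivity of the halfspace-to-facet map: the facet inequalities therefore include all
    inequalities defining \<open>P\<close>.\<close>
  have gF: "\<exists>F. F facet_of P \<and> g F = h" if "h \<in> H" for h
  proof -
    let ?F = "P \<inter> {x. a h \<bullet> x = b h}"
    have F: "?F facet_of P" using facet that by blast
    have "g ?F = h" using inj[OF g(1)[OF F] that] g(2)[OF F] by simp
    then show ?thesis using F by blast
  qed
  show ?thesis
  proof (rule that[of "\<lambda>F. a (g F)" "\<lambda>F. b (g F)"])
    show "a (g F) \<bullet> x \<le> b (g F)" if "F facet_of P" "x \<in> P" for F x
      using that(2) g(1)[OF that(1)] memP by blast
    show "F = P \<inter> {x. a (g F) \<bullet> x = b (g F)}" if "F facet_of P" for F
      using g that by blast
    show "x + a (g F) \<in> affine hull P" if "F facet_of P" "x \<in> affine hull P" for F x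
      using para g that by blast
    show "x \<in> P" if "x \<in> affine hull P" and *: "\<And>F. F facet_of P \<Longrightarrow> a (g F) \<bullet> x \<le> b (g F)" for x
    proof -
      have "a h \<bullet> x \<le> b h" if h: "h \<in> H" for h
        using gF[OF h] * by blast
      then show ?thesis using that(1) memP by blast
    qed
  qed
qed

text \<open>Every vertex is a proper face and lies in some facet; with a single facet
  \<open>F\<close> all vertices, hence all of \<open>Q\<close>, would lie in
  \<open>F\<close>.\<close>

lemma polytope_facets_ge_2:
  fixes Q :: "'a::euclidean_space set"
  assumes "polytope Q" "0 < aff_dim Q"
  shows "2 \<le> card (facets Q)"
proof -
  have fin: "finite (facets Q)"
    using finite_polytope_facets[OF assms(1)] by (simp add: facets_def)
  obtain F where F: "F facet_of Q" using polytope_facet_exists assms by blast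
  have "\<exists>G. G facet_of Q \<and> G \<noteq> F"
  proof (rule ccontr)
    assume none: "\<nexists>G. G facet_of Q \<and> G \<noteq> F"
    have "{x. x extreme_point_of Q} \<subseteq> F"
    proof safe
      fix x assume "x extreme_point_of Q"
      moreover have "{x} \<noteq> Q" using assms(2) by auto
      ultimately obtain G where "G facet_of Q" "{x} \<subseteq> G"
        using face_of_polyhedron_subset_facet[of Q "{x}"] assms(1) polytope_imp_polyhedron face_of_singleton
        by (metis insert_not_empty)
      then show "x \<in> F" using none by auto
    qed
    then have "convex hull {x. x extreme_point_of Q} \<subseteq> F"
      using F by (intro hull_minimal) (auto simp: facet_of_def face_of_imp_convex)
    then have "Q \<subseteq> F"
      using Krein_Milman_Minkowski[of Q] assms(1) polytope_imp_compact polytope_imp_convex by auto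
    then show False using F facet_of_imp_subset facet_of_irrefl by (metis subset_antisym)
  qed
  then obtain G where "G facet_of Q" "G \<noteq> F" by blast
  then have "card {F, G} \<le> card (facets Q)" using F fin by (intro card_mono) (auto simp: facets_def)
  then show ?thesis using \<open>G \<noteq> F\<close> by simp
qed

section \<open>Vertices of simple polytopes\<close>

definition adj_vertices :: "'a::euclidean_space set \<Rightarrow> 'a \<Rightarrow> 'a set" where
  "adj_vertices P v = {u. u \<noteq> v \<and> closed_segment v u face_of P}"

lemma adj_vertices_sym: "u \<in> adj_vertices P v \<longleftrightarrow> v \<in> adj_vertices P u"
  unfolding adj_vertices_def by (auto simp: closed_segment_commute)

lemma adj_vertices_subset: "adj_vertices P v \<subseteq> vertices P"
  unfolding adj_vertices_def vertices_def using segment_face_of by auto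

lemma finite_vertices: "polytope P \<Longrightarrow> finite (vertices P)"
  unfolding vertices_def using finite_polyhedron_extreme_points polytope_imp_polyhedron by blast

text \<open>The \<open>d\<close> normals of the facets at \<open>v\<close> form a basis of the
  direction space of \<open>P\<close>, and \<open>Z\<close> is the negated dual basis: moving from
  \<open>v\<close> along \<open>Z F\<close> leaves \<open>F\<close> inwards and stays on the other
  facets at \<open>v\<close>, so \<open>Z F\<close> is an edge direction. The coordinates of
  \<open>x - v\<close> in this frame are the slacks \<open>b F - a F \<bullet> x\<close>.\<close>

lemma simple_vertex_dual_frame:
  fixes P :: "'a::euclidean_space set"
  assumes poly: "polytope P" and dim: "aff_dim P = int d"
    and v: "v \<in> vertices P" and d: "d \<ge> 1"
    and card: "card {F \<in> facets P. v \<in> F} = d"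
  obtains a b Z where
    "\<And>F x. F facet_of P \<Longrightarrow> x \<in> P \<Longrightarrow> a F \<bullet> x \<le> b F"
    "\<And>F. F facet_of P \<Longrightarrow> F = P \<inter> {x. a F \<bullet> x = b F}"
    "\<And>F G. F \<in> facets P \<Longrightarrow> v \<in> F \<Longrightarrow> G \<in> facets P \<Longrightarrow> v \<in> G \<Longrightarrow> a G \<bullet> Z F = (if G = F then -1 else (0::real))"
    "\<And>x. x \<in> P \<Longrightarrow> x - v = (\<Sum>F | F \<in> facets P \<and> v \<in> F. (b F - a F \<bullet> x) *\<^sub>R Z F)"
    "\<And>F. F \<in> facets P \<Longrightarrow> v \<in> F \<Longrightarrow> \<exists>t>0. v + t *\<^sub>R Z F \<in> P"
proof -
  have polyh: "polyhedron P" using poly polytope_imp_polyhedron by blast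
  have vP: "v extreme_point_of P" "v \<in> P" using v by (auto simp: vertices_def extreme_point_of_def)
  obtain a b where
    le: "\<And>F x. F facet_of P \<Longrightarrow> x \<in> P \<Longrightarrow> a F \<bullet> x \<le> b F" and
    eq: "\<And>F. F facet_of P \<Longrightarrow> F = P \<inter> {x. a F \<bullet> x = b F}" and
    par: "\<And>F x. F facet_of P \<Longrightarrow> x \<in> affine hull P \<Longrightarrow> x + a F \<in> affine hull P" and
    sat: "\<And>x. x \<in> affine hull P \<Longrightarrow> (\<And>F. F facet_of P \<Longrightarrow> a F \<bullet> x \<le> b F) \<Longrightarrow> x \<in> P"
    by (rule polyhedron_facet_normals[OF polyh]) (use vP(2) in auto)
  define FF where "FF = {F \<in> facets P. v \<in> F}"
  have finF: "finite (facets P)"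
    using finite_polytope_facets[OF poly] by (simp add: facets_def)
  have FF: "finite FF" "card FF = d" using card finF by (auto simp: FF_def)
  have FFD: "F facet_of P" "v \<in> F" "a F \<bullet> v = b F" if "F \<in> FF" for F
    using that eq[of F] by (auto simp: FF_def facets_def)
  define X where "X = (\<lambda>x. x - v) ` P"
  have L: "z \<in> span X \<longleftrightarrow> v + z \<in> affine hull P" for z
  proof -
    have "span X = (\<lambda>x. x - v) ` (affine hull P)" unfolding X_def using diffs_affine_hull_span[OF vP(2)] by simp
    then show ?thesis by (auto simp: image_iff) (metis add_diff_cancel_left')
  qed
  have dimL: "dim (span X) = d"
    using aff_dim_eq_dim_subtract[of v P] dim vP(2) by (simp add: X_def hull_inc)
  have aL: "a F \<in> span X" if "F \<in> FF" for F
    using par[OF FFD(1)[OF that]] vP(2) L by (simp add: hull_inc)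
  \<comment> \<open>Near \<open>v\<close> only the facets through \<open>v\<close> constrain; all
    others have slack at \<open>v\<close>, which survives small moves by continuity.\<close>
  have local: "\<exists>t>0. v + t *\<^sub>R z \<in> P" if z: "z \<in> span X" and az: "\<And>F. F \<in> FF \<Longrightarrow> a F \<bullet> z \<le> 0" for z
  proof -
    have "\<forall>F\<in>facets P. eventually (\<lambda>t. a F \<bullet> (v + t *\<^sub>R z) \<le> b F) (at_right 0)"
    proof
      fix F assume F: "F \<in> facets P"
      show "eventually (\<lambda>t. a F \<bullet> (v + t *\<^sub>R z) \<le> b F) (at_right 0)"
      proof (cases "F \<in> FF")
        case True
        have "eventually (\<lambda>t. t > (0::real)) (at_right 0)" by (simp add: eventually_at_right_less)
        then show ?thesis
          by eventually_elim
            (use az[OF True] FFD(3)[OF True] in \<open>auto simp: inner_add_right mult_nonneg_nonpos\<close>)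
      next
        case False
        then have "a F \<bullet> v < b F" using le[of F v] eq[of F] F vP(2) by (force simp: FF_def facets_def)
        moreover have "((\<lambda>t. a F \<bullet> (v + t *\<^sub>R z)) \<longlongrightarrow> a F \<bullet> (v + 0 *\<^sub>R z)) (at_right 0)"
          by (intro tendsto_intros)
        ultimately have "eventually (\<lambda>t. a F \<bullet> (v + t *\<^sub>R z) < b F) (at_right 0)"
          by (intro order_tendstoD) auto
        then show ?thesis by eventually_elim simp
      qed
    qed
    then have "eventually (\<lambda>t. \<forall>F\<in>facets P. a F \<bullet> (v + t *\<^sub>R z) \<le> b F) (at_right 0)"
      using finF by (rule eventually_ball_finite[rotated])
    moreover have "eventually (\<lambda>t. t > (0::real)) (at_right 0)" by (simp add: eventually_at_right_less)
    ultimately have "eventually (\<lambda>t. t > 0 \<and> (\<forall>F\<in>facets P. a F \<bullet> (v + t *\<^sub>R z) \<le> b F)) (at_right 0)"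
      by eventually_elim simp
    from eventually_happens[OF this] obtain t :: real where t: "t > 0" "\<And>F. F \<in> facets P \<Longrightarrow> a F \<bullet> (v + t *\<^sub>R z) \<le> b F"
      by (auto simp: trivial_limit_at_right_real)
    have "v + t *\<^sub>R z \<in> affine hull P" using L[of "t *\<^sub>R z"] z span_scale by blast
    then have "v + t *\<^sub>R z \<in> P" using t by (intro sat) (auto simp: facets_def)
    then show ?thesis using t by blast
  qed
  \<comment> \<open>Such a \<open>z\<close> moves \<open>v\<close> within every facet through
    \<open>v\<close>, and these intersect in \<open>{v}\<close> alone.\<close>
  have ker: "z = 0" if z: "z \<in> span X" and az: "\<And>F. F \<in> FF \<Longrightarrow> a F \<bullet> z = 0" for z
  proof -
    obtain t where t: "t > 0" "v + t *\<^sub>R z \<in> P" using local[OF z] az by fastforce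
    have "{v} \<noteq> P" using dim d by auto
    then have "{v} = \<Inter>{F. F facet_of P \<and> {v} \<subseteq> F}"
      using vP by (intro face_of_polyhedron[OF polyh]) (auto simp: face_of_singleton)
    moreover have "v + t *\<^sub>R z \<in> F" if "F facet_of P \<and> {v} \<subseteq> F" for F
    proof -
      have F: "F \<in> FF" using that by (auto simp: FF_def facets_def)
      have "a F \<bullet> (v + t *\<^sub>R z) = b F" using az[OF F] FFD(3)[OF F] by (simp add: inner_add_right)
      then show ?thesis using eq[of F] t(2) that by blast
    qed
    ultimately have "v + t *\<^sub>R z \<in> {v}" by blast
    then show ?thesis using t(1) by simp
  qed
  have aFFL: "span (a ` FF) \<subseteq> span X"
    using aL by (intro span_minimal) auto
  have spanA: "span (a ` FF) = span X"
  proof (rule ccontr)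
    assume "span (a ` FF) \<noteq> span X"
    then have "span (a ` FF) \<subset> span X" using aFFL by blast
    then obtain z where z: "z \<noteq> 0" "z \<in> span X" "\<And>y. y \<in> span (a ` FF) \<Longrightarrow> orthogonal z y"
      by (rule orthogonal_to_subspace_exists_gen) blast
    have "a F \<bullet> z = 0" if "F \<in> FF" for F
      using z(3)[OF span_base[OF imageI[OF that]]] by (simp add: orthogonal_def inner_commute)
    then show False using ker z by blast
  qed
  have cardA: "card (a ` FF) \<le> d" using card_image_le[OF FF(1), of a] FF(2) by simp
  \<comment> \<open>Simplicity enters here: at most \<open>d\<close> vectors spanning a space of
    dimension \<open>d\<close> are independent.\<close>
  have indepA: "independent (a ` FF)"
    using aL spanA FF(1) cardA dimL by (intro card_le_dim_spanning[of _ "span X"]) auto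
  have "card (a ` FF) = d"
    using dim_eq_card[of "a ` FF" "span X"] indepA spanA dimL by (simp add: span_span)
  then have injA: "inj_on a FF" using FF eq_card_imp_inj_on by metis
  \<comment> \<open>Take \<open>z\<close> in the span of all normals orthogonal to every normal but
    \<open>a F\<close>. By \<open>ker\<close> it pairs nontrivially with \<open>a F\<close>, and
    scaling makes this pairing -1, the sign that points into \<open>P\<close>.\<close>
  have "\<exists>z. z \<in> span X \<and> (\<forall>G\<in>FF. a G \<bullet> z = (if G = F then -1 else 0))" if F: "F \<in> FF" for F
  proof -
    have img: "a ` (FF - {F}) = a ` FF - {a F}" using injA F by (auto simp: inj_on_def)
    have "a F \<notin> span (a ` (FF - {F}))"
      using indepA F unfolding img dependent_def by blast
    moreover have "a F \<in> span (a ` FF)" using F by (simp add: span_base)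
    ultimately have "span (a ` (FF - {F})) \<subset> span (a ` FF)"
      by (metis Diff_subset image_mono psubsetI span_mono)
    then obtain z where z: "z \<noteq> 0" "z \<in> span (a ` FF)" "\<And>y. y \<in> span (a ` (FF - {F})) \<Longrightarrow> orthogonal z y"
      by (rule orthogonal_to_subspace_exists_gen) blast
    have zG: "a G \<bullet> z = 0" if "G \<in> FF" "G \<noteq> F" for G
      using z(3)[OF span_base[of "a G"]] that by (simp add: orthogonal_def inner_commute)
    have "a F \<bullet> z \<noteq> 0"
      using ker[of z] z zG spanA by metis
    then show ?thesis
      using z(2) zG spanA by (intro exI[of _ "(- 1 / (a F \<bullet> z)) *\<^sub>R z"]) (auto intro!: span_neg span_scale)
  qed
  then obtain Z where Z: "\<And>F. F \<in> FF \<Longrightarrow> Z F \<in> span X"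
      "\<And>F G. F \<in> FF \<Longrightarrow> G \<in> FF \<Longrightarrow> a G \<bullet> Z F = (if G = F then -1 else 0)" by metis
  have rep: "x - v = (\<Sum>F\<in>FF. (b F - a F \<bullet> x) *\<^sub>R Z F)" if x: "x \<in> P" for x
  proof -
    let ?z = "x - v - (\<Sum>F\<in>FF. (b F - a F \<bullet> x) *\<^sub>R Z F)"
    have "x - v \<in> span X" using x by (intro span_base) (auto simp: X_def)
    then have "?z \<in> span X" using Z(1) by (intro span_diff[of "x - v"] span_sum span_scale)
    moreover have "a G \<bullet> ?z = 0" if G: "G \<in> FF" for G
    proof -
      have "a G \<bullet> (\<Sum>F\<in>FF. (b F - a F \<bullet> x) *\<^sub>R Z F) = (\<Sum>F\<in>FF. if F = G then - (b G - a G \<bullet> x) else 0)"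
        unfolding inner_sum_right using Z(2)[OF _ G] by (intro sum.cong) auto
      also have "\<dots> = - (b G - a G \<bullet> x)" using FF(1) G by (simp add: sum.delta)
      finally show ?thesis using FFD(3)[OF G] by (simp add: inner_diff_right)
    qed
    ultimately have "?z = 0" by (rule ker)
    then show ?thesis by simp
  qed
  show ?thesis
  proof (rule that[of a b Z])
    show "\<exists>t>0. v + t *\<^sub>R Z F \<in> P" if "F \<in> facets P" "v \<in> F" for F
      using that Z by (intro local) (auto simp: FF_def)
  qed (use le eq Z rep in \<open>auto simp: FF_def\<close>)
qed

text \<open>The parameters that stay in a compact \<open>P\<close> form a compact set because
  \<open>z\<close> is nonzero. The largest one will give the far end of an edge at
  \<open>v\<close>.\<close>

lemma closed_ray_max:
  fixes P :: "'a::euclidean_space set"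
  assumes "compact P" "v + t0 *\<^sub>R z \<in> P" "t0 > 0" "z \<noteq> 0"
  obtains t where "t > 0" "v + t *\<^sub>R z \<in> P" "\<forall>s. v + s *\<^sub>R z \<in> P \<longrightarrow> s \<le> t"
proof -
  let ?T = "{t. v + t *\<^sub>R z \<in> P}"
  have "closed ?T"
    using continuous_closed_vimage[OF compact_imp_closed[OF assms(1)], of "\<lambda>t. v + t *\<^sub>R z"]
    by (auto simp: vimage_def intro!: continuous_intros)
  moreover have "bounded ?T"
  proof -
    obtain B where B: "\<And>x. x \<in> P \<Longrightarrow> norm x \<le> B"
      using compact_imp_bounded[OF assms(1)] by (auto simp: bounded_iff)
    have "norm t \<le> (B + norm v) / norm z" if "v + t *\<^sub>R z \<in> P" for t
    proof -
      have "\<bar>t\<bar> * norm z \<le> norm (v + t *\<^sub>R z) + norm v"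
        using norm_triangle_ineq4[of "v + t *\<^sub>R z" v] by simp
      also have "\<dots> \<le> B + norm v" using B[OF that] by simp
      finally show ?thesis using assms(4) by (simp add: field_simps)
    qed
    then show ?thesis by (auto simp: bounded_iff)
  qed
  ultimately have "compact ?T" by (simp add: compact_eq_bounded_closed)
  moreover have "?T \<noteq> {}" using assms by blast
  ultimately have "\<exists>t\<in>?T. \<forall>s\<in>?T. s \<le> t" by (rule compact_attains_sup)
  then obtain t where t: "t \<in> ?T" "\<forall>s\<in>?T. s \<le> t" by blast
  then have "t0 \<le> t" using assms(2) by blast
  then show ?thesis using that[of t] t assms(3) by simp
qed

text \<open>Use the slacks \<open>b F - a F \<bullet> x\<close>, divided by the edge lengths
  \<open>T F\<close>, as coordinates. Then \<open>v\<close> is the origin, its neighbours are the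
  unit vectors, and \<open>c \<bullet> x - \<beta>\<close> is the coordinate sum minus 1. A vertex
  with sum at most 1 lies in the simplex spanned by \<open>v\<close> and its neighbours, so
  extremality makes it one of these points.\<close>

lemma simple_vertex_neighbours:
  fixes P :: "'a::euclidean_space set"
  assumes poly: "polytope P" and dim: "aff_dim P = int d"
    and v: "v \<in> vertices P" and d: "d \<ge> 2"
    and card: "card {F \<in> facets P. v \<in> F} = d"
  obtains c \<beta> where "card (adj_vertices P v) = d" "\<not> affine_dependent (insert v (adj_vertices P v))"
    "\<And>F. F \<in> facets P \<Longrightarrow> v \<in> F \<Longrightarrow> card (adj_vertices P v \<inter> F) = d - 1"
    "c \<bullet> v < \<beta>" "\<And>u. u \<in> adj_vertices P v \<Longrightarrow> c \<bullet> u = \<beta>"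
    "\<And>w. w \<in> vertices P \<Longrightarrow> w \<noteq> v \<Longrightarrow> w \<notin> adj_vertices P v \<Longrightarrow> c \<bullet> w > \<beta>"
proof -
  define FF where "FF = {F \<in> facets P. v \<in> F}"
  have vP: "v extreme_point_of P" "v \<in> P" using v by (auto simp: vertices_def extreme_point_of_def)
  have d1: "d \<ge> 1" using d by simp
  show ?thesis
  proof (rule simple_vertex_dual_frame[OF poly dim v d1 card])
    fix a :: "'a set \<Rightarrow> 'a" and b :: "'a set \<Rightarrow> real" and Z :: "'a set \<Rightarrow> 'a"
    assume
      le: "\<And>F x. F facet_of P \<Longrightarrow> x \<in> P \<Longrightarrow> a F \<bullet> x \<le> b F" and
      eq: "\<And>F. F facet_of P \<Longrightarrow> F = P \<inter> {x. a F \<bullet> x = b F}" and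
      aZ': "\<And>F G. F \<in> facets P \<Longrightarrow> v \<in> F \<Longrightarrow> G \<in> facets P \<Longrightarrow> v \<in> G \<Longrightarrow> a G \<bullet> Z F = (if G = F then -1 else (0::real))" and
      rep': "\<And>x. x \<in> P \<Longrightarrow> x - v = (\<Sum>F | F \<in> facets P \<and> v \<in> F. (b F - a F \<bullet> x) *\<^sub>R Z F)" and
      small': "\<And>F. F \<in> facets P \<Longrightarrow> v \<in> F \<Longrightarrow> \<exists>t>0. v + t *\<^sub>R Z F \<in> P"
    have FF: "finite FF" "card FF = d"
      using card finite_polytope_facets[OF poly] by (auto simp: FF_def facets_def)
    have FFD: "F facet_of P" "v \<in> F" "a F \<bullet> v = b F" if "F \<in> FF" for F
      using that eq[of F] by (auto simp: FF_def facets_def)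
    have aZ: "a G \<bullet> Z F = (if G = F then -1 else 0)" if "F \<in> FF" "G \<in> FF" for F G
      using that aZ' by (auto simp: FF_def)
    have rep: "x - v = (\<Sum>F\<in>FF. (b F - a F \<bullet> x) *\<^sub>R Z F)" if "x \<in> P" for x
      using rep'[OF that] by (simp add: FF_def)
    have Z0: "Z F \<noteq> 0" if "F \<in> FF" for F using aZ[OF that that] by auto
    have mem: "x \<in> F \<longleftrightarrow> a F \<bullet> x = b F" if "F \<in> FF" "x \<in> P" for F x
      using eq[OF FFD(1)[OF that(1)]] that(2) by blast
    have "\<exists>t. t > 0 \<and> v + t *\<^sub>R Z F \<in> P \<and> (\<forall>s. v + s *\<^sub>R Z F \<in> P \<longrightarrow> s \<le> t)" if F: "F \<in> FF" for F
    proof -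
      obtain t0 where "t0 > 0" "v + t0 *\<^sub>R Z F \<in> P" using small' F by (auto simp: FF_def)
      then obtain t where "t > 0" "v + t *\<^sub>R Z F \<in> P" "\<forall>s. v + s *\<^sub>R Z F \<in> P \<longrightarrow> s \<le> t"
        using closed_ray_max[OF polytope_imp_compact[OF poly] _ _ Z0[OF F]] by blast
      then show ?thesis by blast
    qed
    then obtain T where T: "\<And>F. F \<in> FF \<Longrightarrow> T F > 0" "\<And>F. F \<in> FF \<Longrightarrow> v + T F *\<^sub>R Z F \<in> P"
       "\<And>F s. F \<in> FF \<Longrightarrow> v + s *\<^sub>R Z F \<in> P \<Longrightarrow> s \<le> T F" by metis
    have T0: "T F \<noteq> 0" if "F \<in> FF" for F using T(1)[OF that] by simp
    \<comment> \<open>The far end of the edge at \<open>v\<close> that leaves \<open>F\<close>; it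
      lies on all other facets through \<open>v\<close> but not on \<open>F\<close>.\<close>
    define U where "U F = v + T F *\<^sub>R Z F" for F
    have aU: "a G \<bullet> U F = (if G = F then b G - T F else b G)" if "F \<in> FF" "G \<in> FF" for F G
      using aZ[OF that] FFD(3)[OF that(2)] by (simp add: U_def inner_add_right)
    have UP: "U F \<in> P" if "F \<in> FF" for F using T(2)[OF that] by (simp add: U_def)
    have Uv: "U F \<noteq> v" if "F \<in> FF" for F using T(1)[OF that] Z0[OF that] by (simp add: U_def)
    have UG: "U F \<in> G \<longleftrightarrow> G \<noteq> F" if "F \<in> FF" "G \<in> FF" for F G
      using mem[OF that(2) UP[OF that(1)]] aU[OF that] T(1)[OF that(1)] by auto
    have injU: "inj_on U FF"
    proof (rule inj_onI, rule ccontr)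
      fix F G assume FG: "F \<in> FF" "G \<in> FF" "U F = U G" "F \<noteq> G"
      then show False using UG[OF FG(1) FG(1)] UG[OF FG(2) FG(1)] by simp
    qed
    \<comment> \<open>Only the coordinate along \<open>Z F\<close> can be nonzero, so
      \<open>x\<close> is on the ray from \<open>v\<close>; maximality of \<open>T F\<close> bounds
      how far out.\<close>
    have single: "x \<in> closed_segment v (U F)" if F: "F \<in> FF" and x: "x \<in> P" "\<And>G. G \<in> FF \<Longrightarrow> G \<noteq> F \<Longrightarrow> x \<in> G" for F x
    proof -
      define s where "s = b F - a F \<bullet> x"
      have "x - v = (\<Sum>G\<in>FF. if G = F then s *\<^sub>R Z F else 0)"
        unfolding rep[OF x(1)] using mem[OF _ x(1)] x(2) by (intro sum.cong) (auto simp: s_def)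
      then have xs: "x = v + s *\<^sub>R Z F" using FF(1) F by (simp add: algebra_simps)
      have s0: "0 \<le> s" using le[OF FFD(1)[OF F] x(1)] by (simp add: s_def)
      have "v + s *\<^sub>R Z F \<in> P" using x(1) by (subst xs[symmetric])
      note s = s0 T(3)[OF F this]
      have "x = (1 - s / T F) *\<^sub>R v + (s / T F) *\<^sub>R U F"
        using T(1)[OF F] by (subst xs) (simp add: U_def algebra_simps)
      then show ?thesis using s T(1)[OF F] unfolding closed_segment_def
        by (intro CollectI exI[of _ "s / T F"]) auto
    qed
    have UN: "U F \<in> adj_vertices P v" if F: "F \<in> FF" for F
    proof -
      \<comment> \<open>This is where \<open>d \<ge> 2\<close> is needed: the edge is the
        intersection of a nonempty family of facets.\<close>
      have ne: "FF - {F} \<noteq> {}"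
      proof
        assume "FF - {F} = {}"
        then have "card FF \<le> card {F}" by (intro card_mono) auto
        then show False using FF(2) d by simp
      qed
      have face: "\<Inter>(FF - {F}) face_of P"
        using FFD(1) by (intro face_of_Inter[OF ne]) (auto intro: facet_of_imp_face_of)
      have "\<Inter>(FF - {F}) = closed_segment v (U F)"
      proof
        have "\<Inter>(FF - {F}) \<subseteq> P" using face face_of_imp_subset by blast
        then show "\<Inter>(FF - {F}) \<subseteq> closed_segment v (U F)"
          using single[OF F] by blast
        have "v \<in> \<Inter>(FF - {F})" "U F \<in> \<Inter>(FF - {F})" using FFD(2) UG[OF F] by auto
        then show "closed_segment v (U F) \<subseteq> \<Inter>(FF - {F})"
          using face_of_imp_convex[OF face] closed_segment_subset by blast
      qed
      then show ?thesis using face Uv[OF F] by (simp add: adj_vertices_def)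
    qed
    have l0: "0 \<le> (b F - a F \<bullet> w) / T F" if "w \<in> P" "F \<in> FF" for w F
      using T(1)[OF that(2)] le[OF FFD(1)[OF that(2)] that(1)] by simp
    \<comment> \<open>Dividing the coordinates by their sum \<open>L\<close> gives the weights of a
      convex combination of the points \<open>U F\<close>: the ray from \<open>v\<close> to
      \<open>w\<close> meets their hull.\<close>
    have scaled: "v + (1 / L) *\<^sub>R (w - v) \<in> convex hull (U ` FF)"
      if w: "w \<in> P" and L: "L = (\<Sum>F\<in>FF. (b F - a F \<bullet> w) / T F)" "L > 0" for w L
    proof -
      let ?l = "\<lambda>F. (b F - a F \<bullet> w) / T F"
      have s1: "(\<Sum>F\<in>FF. ?l F / L) = 1" using L by (simp only: sum_divide_distrib[symmetric]) simp
      have "w - v = (\<Sum>F\<in>FF. ?l F *\<^sub>R (U F - v))"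
        unfolding rep[OF w] using T0 by (intro sum.cong) (auto simp: U_def)
      then have "(1 / L) *\<^sub>R (w - v) = (\<Sum>F\<in>FF. (?l F / L) *\<^sub>R (U F - v))"
        by (simp add: scaleR_sum_right mult.commute)
      also have "\<dots> = (\<Sum>F\<in>FF. (?l F / L) *\<^sub>R U F) - (\<Sum>F\<in>FF. ?l F / L) *\<^sub>R v"
        by (simp only: scaleR_diff_right sum_subtractf scaleR_sum_left)
      finally have "v + (1 / L) *\<^sub>R (w - v) = (\<Sum>F\<in>FF. (?l F / L) *\<^sub>R U F)"
        unfolding s1 by simp
      also have "\<dots> \<in> convex hull (U ` FF)"
        using divide_nonneg_pos[OF l0[OF w] L(2)] s1
        by (intro convex_sum[OF FF(1) convex_convex_hull]) (auto simp: hull_inc simp del: divide_divide_eq_left)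
      finally show ?thesis .
    qed
    have hull: "w \<in> convex hull (insert v (U ` FF))" if w: "w \<in> P" "(\<Sum>F\<in>FF. (b F - a F \<bullet> w) / T F) \<le> 1" for w
    proof (cases "(\<Sum>F\<in>FF. (b F - a F \<bullet> w) / T F) = 0")
      case True
      then have "(b F - a F \<bullet> w) / T F = 0" if "F \<in> FF" for F
        using sum_nonneg_eq_0_iff[OF FF(1), of "\<lambda>F. (b F - a F \<bullet> w) / T F"] l0[OF w(1)] that by blast
      then have "b F - a F \<bullet> w = 0" if "F \<in> FF" for F using T(1)[OF that] that by fastforce
      then have "w - v = 0" unfolding rep[OF w(1)] by simp
      then show ?thesis by (simp add: hull_inc)
    next
      case False
      define L where "L = (\<Sum>F\<in>FF. (b F - a F \<bullet> w) / T F)"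
      have L: "0 < L" "L \<le> 1" using False sum_nonneg[of FF "\<lambda>F. (b F - a F \<bullet> w) / T F"] l0[OF w(1)] w(2)
        by (force simp: L_def)+
      have "v + (1 / L) *\<^sub>R (w - v) \<in> convex hull (insert v (U ` FF))"
        using scaled[OF w(1) L_def L(1)] hull_mono[of "U ` FF" "insert v (U ` FF)"] by blast
      then have "(1 - L) *\<^sub>R v + L *\<^sub>R (v + (1 / L) *\<^sub>R (w - v)) \<in> convex hull (insert v (U ` FF))"
        using L by (intro convexD[OF convex_convex_hull]) (auto simp: hull_inc)
      moreover have "(1 - L) *\<^sub>R v + L *\<^sub>R (v + (1 / L) *\<^sub>R (w - v)) = w"
        using L by (simp add: algebra_simps)
      ultimately show ?thesis by simp
    qed
    have extreme: "w \<in> insert v (U ` FF)" if w: "w extreme_point_of P" "w \<in> convex hull (insert v (U ` FF))" for w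
    proof -
      have "convex hull (insert v (U ` FF)) \<subseteq> P"
        using vP(2) UP polytope_imp_convex[OF poly] by (intro hull_minimal) auto
      then have "w extreme_point_of (convex hull (insert v (U ` FF)))"
        using w by (auto simp: extreme_point_of_def)
      then show ?thesis using extreme_point_of_convex_hull by blast
    qed
    have NU: "adj_vertices P v = U ` FF"
    proof
      show "U ` FF \<subseteq> adj_vertices P v" using UN by blast
      show "adj_vertices P v \<subseteq> U ` FF"
      proof
        fix u assume u: "u \<in> adj_vertices P v"
        then have uv: "u \<noteq> v" and face: "closed_segment v u face_of P" by (auto simp: adj_vertices_def)
        have ue: "u extreme_point_of P" using segment_face_of[OF face] by blast
        then have uP: "u \<in> P" by (simp add: extreme_point_of_def)
        show "u \<in> U ` FF"
        proof (cases "(\<Sum>F\<in>FF. (b F - a F \<bullet> u) / T F) \<le> 1")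
          case True
          then show ?thesis using extreme[OF ue hull[OF uP]] uv by blast
        next
          case False
          let ?L = "\<Sum>F\<in>FF. (b F - a F \<bullet> u) / T F"
          let ?K = "convex hull (U ` FF)"
          have L: "?L > 1" using False by simp
          \<comment> \<open>The point where the segment from \<open>v\<close> to \<open>u\<close>
            meets the simplex \<open>?K\<close>. Since the segment is a face of \<open>P\<close>, it
            cuts \<open>?K\<close> in a face of \<open>?K\<close>, which therefore contains some
            \<open>U F\<close>. This is a vertex of \<open>P\<close> on the segment other than
            \<open>v\<close>, hence it is \<open>u\<close>.\<close>
          define y where "y = v + (1 / ?L) *\<^sub>R (u - v)"
          have yK: "y \<in> ?K" unfolding y_def using L by (intro scaled[OF uP]) auto
          have "y = (1 - 1 / ?L) *\<^sub>R v + (1 / ?L) *\<^sub>R u" by (simp add: y_def algebra_simps)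
          then have yT: "y \<in> closed_segment v u" unfolding closed_segment_def using L
            by (intro CollectI exI[of _ "1 / ?L"]) auto
          have "?K \<subseteq> P" using UP polytope_imp_convex[OF poly] by (intro hull_minimal) auto
          then have fK: "closed_segment v u \<inter> ?K face_of ?K"
            using face_of_slice[OF face convex_convex_hull[of "U ` FF"]] by (simp add: Int_absorb1)
          have cU: "compact (U ` FF)" using FF(1) by (simp add: finite_imp_compact)
          obtain S' where S': "S' \<subseteq> U ` FF" "closed_segment v u \<inter> ?K = convex hull S'"
            by (rule face_of_convex_hull_subset[OF cU fK])
          have "S' \<noteq> {}" using S'(2) yK yT by auto
          then obtain F where F: "F \<in> FF" "U F \<in> S'" using S'(1) by blast
          then have "U F \<in> closed_segment v u" using S'(2) hull_inc[of "U F" S'] by blast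
          moreover have "U F extreme_point_of P"
            using UN[OF F(1)] adj_vertices_subset[of P v] by (auto simp: vertices_def)
          then have "U F \<notin> open_segment v u" using vP(2) uP by (auto simp: extreme_point_of_def)
          ultimately have "U F = u" using Uv[OF F(1)] by (auto simp: open_segment_def)
          then show ?thesis using F(1) by blast
        qed
      qed
    qed
    define c where "c = - (\<Sum>F\<in>FF. (1 / T F) *\<^sub>R a F)"
    define \<beta> where "\<beta> = 1 - (\<Sum>F\<in>FF. b F / T F)"
    have cx: "c \<bullet> x - \<beta> = (\<Sum>F\<in>FF. (b F - a F \<bullet> x) / T F) - 1" for x
      by (simp add: c_def \<beta>_def inner_sum_left diff_divide_distrib sum_subtractf)
    have vN: "v \<notin> U ` FF" using Uv by blast
    \<comment> \<open>As \<open>P\<close> has dimension \<open>d\<close>, the \<open>d + 1\<close>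
      points \<open>v\<close> and \<open>U F\<close> must be affinely independent.\<close>
    have Pspan: "P \<subseteq> affine hull (insert v (U ` FF))"
    proof
      fix x assume x: "x \<in> P"
      have "Z F \<in> span ((\<lambda>x. - v + x) ` U ` FF)" if "F \<in> FF" for F
      proof -
        have "Z F = (1 / T F) *\<^sub>R (- v + U F)" using T(1)[OF that] by (simp add: U_def)
        also have "\<dots> \<in> span ((\<lambda>x. - v + x) ` U ` FF)" using that by (intro span_scale span_base) auto
        finally show ?thesis .
      qed
      then have "x - v \<in> span ((\<lambda>x. - v + x) ` U ` FF)"
        unfolding rep[OF x] by (intro span_sum span_scale)
      then show "x \<in> affine hull (insert v (U ` FF))"
        unfolding affine_hull_insert_span_gen by (intro image_eqI[of _ _ "x - v"]) auto
    qed
    have cardN: "card (U ` FF) = d" using card_image[OF injU] FF by simp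
    show ?thesis
    proof (rule that)
      show "card (adj_vertices P v) = d" using NU cardN by simp
      have "int d \<le> aff_dim (insert v (U ` FF))"
        using aff_dim_subset[OF Pspan] dim by simp
      moreover have "aff_dim (insert v (U ` FF)) \<le> int (card (insert v (U ` FF))) - 1"
        using FF(1) by (intro aff_dim_le_card) auto
      ultimately show "\<not> affine_dependent (insert v (adj_vertices P v))"
        unfolding NU affine_independent_iff_card using FF(1) vN cardN by auto
      show "card (adj_vertices P v \<inter> F) = d - 1" if "F \<in> facets P" "v \<in> F" for F
      proof -
        have F: "F \<in> FF" using that by (simp add: FF_def)
        have "adj_vertices P v \<inter> F = U ` (FF - {F})" unfolding NU using UG[OF _ F] by auto
        moreover have "card (U ` (FF - {F})) = card (FF - {F})"
          using injU by (intro card_image) (auto intro: inj_on_subset)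
        ultimately show ?thesis using FF F by simp
      qed
      have "(\<Sum>F\<in>FF. (b F - a F \<bullet> v) / T F) = 0" using FFD(3) by (intro sum.neutral) auto
      then show "c \<bullet> v < \<beta>" using cx[of v] by simp
      show "c \<bullet> u = \<beta>" if u: "u \<in> adj_vertices P v" for u
      proof -
        obtain F where F: "F \<in> FF" "u = U F" using u NU by blast
        have "(\<Sum>G\<in>FF. (b G - a G \<bullet> u) / T G) = (\<Sum>G\<in>FF. if G = F then 1 else 0)"
          using aU[OF F(1)] T(1)[OF F(1)] F(2) by (intro sum.cong) auto
        also have "\<dots> = 1" using FF(1) F(1) by simp
        finally show ?thesis using cx[of u] by simp
      qed
      show "c \<bullet> w > \<beta>" if w: "w \<in> vertices P" "w \<noteq> v" "w \<notin> adj_vertices P v" for w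
      proof (rule ccontr)
        assume "\<not> c \<bullet> w > \<beta>"
        then have "(\<Sum>F\<in>FF. (b F - a F \<bullet> w) / T F) \<le> 1" using cx[of w] by simp
        moreover have "w extreme_point_of P" "w \<in> P" using w(1) by (auto simp: vertices_def extreme_point_of_def)
        ultimately have "w \<in> insert v (U ` FF)" using extreme hull by blast
        then show False using w NU by blast
      qed
    qed
  qed
qed

section \<open>Facets of the hull of a set of vertices\<close>

text \<open>By dimension \<open>G\<close> spans the section of \<open>A\<close> by
  \<open>c \<bullet> x = \<beta>\<close>, so the segment from \<open>v\<close> to \<open>s\<close>
  crosses \<open>affine hull G\<close>, where \<open>c'\<close> takes the value
  \<open>\<beta>'\<close>. There a positive combination of two nonnegative excesses vanishes, so
  both vanish. This is the tool for showing that faces of \<open>Q\<close> obtained from different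
  objects differ.\<close>

lemma hyperplane_supporting_both_sides:
  fixes A G :: "'a::euclidean_space set"
  assumes A: "affine A" and G: "G \<subseteq> A" "G \<noteq> {}" and dim: "aff_dim A \<le> aff_dim G + 1"
    and c: "\<And>x. x \<in> G \<Longrightarrow> c \<bullet> x = \<beta>" and c': "\<And>x. x \<in> G \<Longrightarrow> c' \<bullet> x = \<beta>'"
    and v: "v \<in> A" "c \<bullet> v < \<beta>" "c' \<bullet> v \<ge> \<beta>'"
    and s: "s \<in> A" "c \<bullet> s > \<beta>" "c' \<bullet> s \<ge> \<beta>'"
  shows "c' \<bullet> v = \<beta>'" "c' \<bullet> s = \<beta>'"
proof -
  have sub: "affine hull G \<subseteq> A \<inter> {x. c \<bullet> x = \<beta>}"
    using G c A by (intro hull_minimal affine_Int affine_hyperplane) auto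
  have "aff_dim (A \<inter> {x. c \<bullet> x = \<beta>}) \<le> aff_dim A - 1"
  proof -
    have "affine hull G \<noteq> {}" using G(2) by simp
    then have "A \<inter> {x. c \<bullet> x = \<beta>} \<noteq> {}" using sub by blast
    moreover have "\<not> A \<subseteq> {x. c \<bullet> x = \<beta>}" using v by force
    ultimately show ?thesis by (simp only: aff_dim_affine_Int_hyperplane[OF A] if_False)
  qed
  then have "aff_dim (affine hull G) = aff_dim (A \<inter> {x. c \<bullet> x = \<beta>})"
    using aff_dim_subset[OF sub] dim by simp
  then have hull: "affine hull G = A \<inter> {x. c \<bullet> x = \<beta>}"
    using affine_dim_equal[OF affine_affine_hull affine_Int[OF A affine_hyperplane] _ sub] G(2) by simp
  define t where "t = (\<beta> - c \<bullet> v) / (c \<bullet> s - c \<bullet> v)"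
  have t: "0 < t" "t < 1" using v s by (auto simp: t_def field_simps)
  define y where "y = (1 - t) *\<^sub>R v + t *\<^sub>R s"
  have "c \<bullet> y = c \<bullet> v + t * (c \<bullet> s - c \<bullet> v)" by (simp add: y_def inner_add_right algebra_simps)
  also have "\<dots> = \<beta>" using v s by (simp add: t_def)
  finally have "y \<in> affine hull G"
    unfolding hull y_def using A v(1) s(1) by (simp add: affine_alt)
  moreover have "affine hull G \<subseteq> {x. c' \<bullet> x = \<beta>'}"
    using c' by (intro hull_minimal affine_hyperplane) auto
  ultimately have "(1 - t) * (c' \<bullet> v - \<beta>') + t * (c' \<bullet> s - \<beta>') = 0"
    by (auto simp: y_def inner_add_right algebra_simps)
  moreover have "0 \<le> (1 - t) * (c' \<bullet> v - \<beta>')" "0 \<le> t * (c' \<bullet> s - \<beta>')" using t v s by simp_all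
  ultimately have "(1 - t) * (c' \<bullet> v - \<beta>') = 0" "t * (c' \<bullet> s - \<beta>') = 0" by linarith+
  then show "c' \<bullet> v = \<beta>'" "c' \<bullet> s = \<beta>'" using t by simp_all
qed

text \<open>\<open>F \<inter> G\<close> is a face of both facets, and a proper face of a facet has
  smaller dimension.\<close>

lemma facets_eqI:
  fixes P :: "'a::euclidean_space set"
  assumes "convex P" "F \<in> facets P" "G \<in> facets P" "aff_dim P - 1 \<le> aff_dim (F \<inter> G)"
  shows "F = G"
proof -
  have *: "F \<inter> G = H" if "H = F \<or> H = G" for H
  proof (rule ccontr)
    assume "F \<inter> G \<noteq> H"
    have H: "H face_of P" "aff_dim H = aff_dim P - 1" using that assms by (auto simp: facets_def facet_of_def)
    have "F \<inter> G face_of P" using assms by (auto simp: facets_def facet_of_def intro: face_of_Int)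
    then have "F \<inter> G face_of H" using that face_of_subset H face_of_imp_subset by (metis inf_le1 inf_le2)
    then have "aff_dim (F \<inter> G) < aff_dim H"
      using \<open>F \<inter> G \<noteq> H\<close> face_of_aff_dim_lt face_of_imp_convex[OF H(1)] by blast
    then show False using H assms by simp
  qed
  then show ?thesis by blast
qed

lemma affine_hull_eq_of_aff_dim_le:
  fixes S T :: "'a::euclidean_space set"
  assumes "T \<subseteq> S" "T \<noteq> {}" "aff_dim S \<le> aff_dim T"
  shows "S \<subseteq> affine hull T"
proof -
  have "affine hull T = affine hull S"
    using assms aff_dim_subset[OF assms(1)]
    by (intro affine_dim_equal) (auto simp: hull_mono)
  then show ?thesis using hull_subset by metis
qed

text \<open>The hyperplane through the neighbours of \<open>v\<close>. When \<open>v\<close> is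
  dropped and all its neighbours are kept, it supports the hull of the kept vertices.\<close>

definition cuts_off :: "'a::euclidean_space set \<Rightarrow> 'a \<Rightarrow> 'a \<Rightarrow> real \<Rightarrow> bool" where
  "cuts_off P v c \<beta> \<longleftrightarrow> c \<bullet> v < \<beta> \<and> (\<forall>u\<in>adj_vertices P v. c \<bullet> u = \<beta>) \<and>
     (\<forall>w\<in>vertices P. w \<noteq> v \<longrightarrow> w \<notin> adj_vertices P v \<longrightarrow> c \<bullet> w > \<beta>)"

section \<open>Simple polytopes of dimension at least two\<close>

locale simple_polytope =
  fixes P :: "'a::euclidean_space set" and d :: nat
  assumes simple: "simple_d_polytope d P" and d2: "d \<ge> 2"
begin

lemma poly: "polytope P" and dim: "aff_dim P = int d"
  and facets_at: "v \<in> vertices P \<Longrightarrow> card {F \<in> facets P. v \<in> F} = d"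
  using simple by (auto simp: simple_d_polytope_def d_polytope_def)

lemma fin_vertices: "finite (vertices P)" and fin_facets: "finite (facets P)"
  using finite_vertices[OF poly] finite_polytope_facets[OF poly] by (auto simp: facets_def)

lemma vertices_subset: "vertices P \<subseteq> P"
  by (auto simp: vertices_def extreme_point_of_def)

lemma finite_adj: "finite (adj_vertices P v)"
  using fin_vertices adj_vertices_subset finite_subset by blast

lemma
  assumes v: "v \<in> vertices P"
  shows card_adj: "card (adj_vertices P v) = d"
    and indep_adj: "\<not> affine_dependent (insert v (adj_vertices P v))"
    and card_adj_facet: "\<And>F. F \<in> facets P \<Longrightarrow> v \<in> F \<Longrightarrow> card (adj_vertices P v \<inter> F) = d - 1"
    and cuts_off_exists: "\<exists>c \<beta>. cuts_off P v c \<beta>"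
proof -
  have *: "card (adj_vertices P v) = d \<and> \<not> affine_dependent (insert v (adj_vertices P v)) \<and>
    (\<forall>F\<in>facets P. v \<in> F \<longrightarrow> card (adj_vertices P v \<inter> F) = d - 1) \<and> (\<exists>c \<beta>. cuts_off P v c \<beta>)"
  proof (rule simple_vertex_neighbours[OF poly dim v d2 facets_at[OF v]])
    fix c \<beta>
    assume 1: "card (adj_vertices P v) = d" "\<not> affine_dependent (insert v (adj_vertices P v))"
      and 2: "\<And>F. F \<in> facets P \<Longrightarrow> v \<in> F \<Longrightarrow> card (adj_vertices P v \<inter> F) = d - 1"
      and 3: "c \<bullet> v < \<beta>" "\<And>u. u \<in> adj_vertices P v \<Longrightarrow> c \<bullet> u = \<beta>"
        "\<And>w. w \<in> vertices P \<Longrightarrow> w \<noteq> v \<Longrightarrow> w \<notin> adj_vertices P v \<Longrightarrow> c \<bullet> w > \<beta>"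
    have "cuts_off P v c \<beta>" unfolding cuts_off_def using 3 by simp
    then show ?thesis using 1 2 by blast
  qed
  show "card (adj_vertices P v) = d" "\<not> affine_dependent (insert v (adj_vertices P v))"
    "\<And>F. F \<in> facets P \<Longrightarrow> v \<in> F \<Longrightarrow> card (adj_vertices P v \<inter> F) = d - 1" "\<exists>c \<beta>. cuts_off P v c \<beta>"
    using * by blast+
qed

lemma not_adj_self: "v \<notin> adj_vertices P v"
  by (simp add: adj_vertices_def)

lemma
  assumes v: "v \<in> vertices P"
  shows aff_dim_adj: "aff_dim (adj_vertices P v) = int d - 1"
    and aff_dim_insert_adj: "aff_dim (insert v (adj_vertices P v)) = int d"
proof -
  have "\<not> affine_dependent (adj_vertices P v)"
    using indep_adj[OF v] affine_independent_subset by blast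
  then show "aff_dim (adj_vertices P v) = int d - 1"
    using card_adj[OF v] by (simp add: affine_independent_iff_card)
  show "aff_dim (insert v (adj_vertices P v)) = int d"
    using indep_adj[OF v] card_adj[OF v] not_adj_self finite_adj by (simp add: affine_independent_iff_card)
qed

text \<open>A star consists of just enough affinely independent points to span its facet, so a facet
  containing an included star meets the hull in full facet dimension.\<close>

lemma
  assumes v: "v \<in> vertices P" and F: "F \<in> facets P" "v \<in> F"
  shows card_star: "card (insert v (adj_vertices P v \<inter> F)) = d"
    and aff_dim_star: "aff_dim (insert v (adj_vertices P v \<inter> F)) = int d - 1"
proof -
  show c: "card (insert v (adj_vertices P v \<inter> F)) = d"
    using card_adj_facet[OF v F] not_adj_self[of v] finite_adj d2 by simp
  have "\<not> affine_dependent (insert v (adj_vertices P v \<inter> F))"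
    using indep_adj[OF v] by (rule affine_independent_subset) auto
  then show "aff_dim (insert v (adj_vertices P v \<inter> F)) = int d - 1"
    using c by (simp add: affine_independent_iff_card)
qed

lemma facet_aff_dim: "F \<in> facets P \<Longrightarrow> aff_dim F = int d - 1"
  using dim by (simp add: facets_def facet_of_def)

lemma facet_convex: "F \<in> facets P \<Longrightarrow> convex F"
  by (auto simp: facets_def facet_of_def face_of_imp_convex)

section \<open>Faces of the hull of a fixed vertex set\<close>

context
  fixes S :: "'a set"
  assumes S: "S \<subseteq> vertices P"
begin

definition "full_facets = {F \<in> facets P. \<exists>v\<in>vertices P \<inter> F. insert v (adj_vertices P v \<inter> F) \<subseteq> S}"

definition "cut_vertices = {v \<in> vertices P - S. adj_vertices P v \<subseteq> S}"

lemma finS: "finite S" using S fin_vertices finite_subset by blast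

lemma hull_subset_P: "convex hull S \<subseteq> P"
  using S vertices_subset polytope_imp_convex[OF poly] by (intro hull_minimal) auto

lemma fin_full: "finite full_facets" and fin_cut: "finite cut_vertices"
  using fin_facets fin_vertices by (auto simp: full_facets_def cut_vertices_def)

lemma full_facet_aff_dim:
  assumes "F \<in> full_facets"
  shows "int d - 1 \<le> aff_dim (convex hull S \<inter> F)"
proof -
  obtain v where v: "v \<in> vertices P" "v \<in> F" "F \<in> facets P" "insert v (adj_vertices P v \<inter> F) \<subseteq> S"
    using assms by (auto simp: full_facets_def)
  have "insert v (adj_vertices P v \<inter> F) \<subseteq> convex hull S \<inter> F"
    using v hull_subset[of S convex] by blast
  from aff_dim_subset[OF this] show ?thesis using aff_dim_star[OF v(1,3,2)] by simp
qed

text \<open>Only \<open>v\<close> lies strictly below its cutting hyperplane, and \<open>v\<close>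
  is not in \<open>S\<close>.\<close>

lemma hull_side:
  assumes "v \<in> cut_vertices" "cuts_off P v c \<beta>"
  shows "\<And>s. s \<in> S \<Longrightarrow> c \<bullet> s \<ge> \<beta>" "convex hull S \<subseteq> {x. c \<bullet> x \<ge> \<beta>}"
proof -
  show *: "c \<bullet> s \<ge> \<beta>" if "s \<in> S" for s
    using assms that S unfolding cut_vertices_def cuts_off_def by (cases "s \<in> adj_vertices P v") (force intro: less_imp_le)+
  show "convex hull S \<subseteq> {x. c \<bullet> x \<ge> \<beta>}"
    using * by (intro hull_minimal convex_halfspace_ge) auto
qed

text \<open>All neighbours of \<open>v\<close> are in \<open>S\<close> and \<open>w\<close> is not,
  so \<open>w\<close> is not a neighbour of \<open>v\<close>.\<close>

lemma cut_vertices_other_side: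
  assumes "v \<in> cut_vertices" "w \<in> cut_vertices" "v \<noteq> w" "cuts_off P v c \<beta>"
  shows "c \<bullet> w > \<beta>"
  using assms unfolding cut_vertices_def cuts_off_def by auto

lemma cut_vertex_aff_dim:
  assumes "v \<in> cut_vertices" "cuts_off P v c \<beta>"
  shows "int d - 1 \<le> aff_dim (convex hull S \<inter> {x. c \<bullet> x = \<beta>})"
proof -
  have "adj_vertices P v \<subseteq> convex hull S \<inter> {x. c \<bullet> x = \<beta>}"
    using assms hull_subset[of S convex] unfolding cut_vertices_def cuts_off_def by auto
  from aff_dim_subset[OF this] show ?thesis
    using aff_dim_adj assms(1) by (simp add: cut_vertices_def)
qed

text \<open>The maps \<open>\<phi>\<close> and \<open>\<psi>\<close> send full facets and cut
  vertices to facets of the hull. They are injective with disjoint images: a second hyperplane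
  supporting the face \<open>\<psi> v\<close> would have \<open>v\<close> and a point of
  \<open>S\<close> beyond the cutting hyperplane weakly on one side, hence would contain
  both.\<close>

lemma card_facets_hull_full_dim:
  assumes full: "aff_dim (convex hull S) = int d"
  shows "card full_facets + card cut_vertices \<le> card (facets (convex hull S))"
proof -
  note aff_dim_convex_hull[simp]
  let ?Q = "convex hull S"
  have "\<forall>v\<in>vertices P. \<exists>x. cuts_off P v (fst x) (snd x)" using cuts_off_exists by auto
  from bchoice[OF this] obtain h where h: "\<And>v. v \<in> vertices P \<Longrightarrow> cuts_off P v (fst (h v)) (snd (h v))" by blast
  define c where "c v = fst (h v)" for v
  define \<beta> where "\<beta> v = snd (h v)" for v
  have cut: "cuts_off P v (c v) (\<beta> v)" if "v \<in> cut_vertices" for v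
    using h that by (auto simp: cut_vertices_def c_def \<beta>_def)
  define \<phi> where "\<phi> F = ?Q \<inter> F" for F
  define \<psi> where "\<psi> v = ?Q \<inter> {x. c v \<bullet> x = \<beta> v}" for v
  have facetI: "G \<in> facets ?Q" if "G face_of ?Q" "int d - 1 \<le> aff_dim G" "G \<noteq> ?Q" for G
  proof -
    have "aff_dim G < aff_dim ?Q" using that face_of_aff_dim_lt convex_convex_hull by blast
    then have "aff_dim G = aff_dim ?Q - 1" using that full by simp
    moreover have "G \<noteq> {}" using that(2) d2 by auto
    ultimately show ?thesis using that(1) by (simp add: facets_def facet_of_def)
  qed
  have \<phi>: "\<phi> F \<in> facets ?Q" if F: "F \<in> full_facets" for F
  proof (rule facetI)
    have FP: "F \<in> facets P" using F by (simp add: full_facets_def)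
    show "int d - 1 \<le> aff_dim (\<phi> F)" using full_facet_aff_dim[OF F] by (simp add: \<phi>_def)
    have "F \<inter> ?Q face_of P \<inter> ?Q" using FP by (intro face_of_slice) (auto simp: facets_def facet_of_def)
    then show "\<phi> F face_of ?Q" using hull_subset_P by (simp add: \<phi>_def Int_absorb1 Int_commute)
    have "aff_dim (\<phi> F) \<le> int d - 1"
      using aff_dim_subset[of "\<phi> F" F] facet_aff_dim[OF FP] by (simp add: \<phi>_def)
    then show "\<phi> F \<noteq> ?Q" using full by auto
  qed
  \<comment> \<open>Otherwise \<open>S\<close> would consist of neighbours of \<open>v\<close>,
    which span only dimension \<open>d - 1\<close>.\<close>
  have outside: "\<exists>s\<in>S. c v \<bullet> s > \<beta> v" if v: "v \<in> cut_vertices" for v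
  proof (rule ccontr)
    assume "\<not> ?thesis"
    then have "S \<subseteq> adj_vertices P v"
      using cut[OF v] S v unfolding cuts_off_def cut_vertices_def by auto
    then have "aff_dim S \<le> int d - 1" using aff_dim_subset aff_dim_adj v by (fastforce simp: cut_vertices_def)
    then show False using full by simp
  qed
  have \<psi>: "\<psi> v \<in> facets ?Q" if v: "v \<in> cut_vertices" for v
  proof (rule facetI)
    show "int d - 1 \<le> aff_dim (\<psi> v)" using cut_vertex_aff_dim[OF v cut[OF v]] by (simp add: \<psi>_def)
    show "\<psi> v face_of ?Q" unfolding \<psi>_def using hull_side[OF v cut[OF v]]
      by (intro face_of_Int_supporting_hyperplane_ge) auto
    show "\<psi> v \<noteq> ?Q" using outside[OF v] hull_inc[of _ S convex] by (force simp: \<psi>_def)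
  qed
  have inA: "x \<in> affine hull P" if "x \<in> P" for x using that by (rule hull_inc)
  have inP: "v \<in> P" if "v \<in> cut_vertices \<or> v \<in> S" for v
    using that S vertices_subset by (auto simp: cut_vertices_def)
  have \<psi>A: "\<psi> v \<subseteq> affine hull P" for v
    using hull_subset_P hull_subset[of P affine] by (auto simp: \<psi>_def)
  have \<psi>ne: "\<psi> v \<noteq> {}" if "v \<in> cut_vertices" for v
    using \<psi>[OF that] by (auto simp: facets_def facet_of_def)
  have \<psi>dim: "aff_dim (affine hull P) \<le> aff_dim (\<psi> v) + 1" if "v \<in> cut_vertices" for v
    using cut_vertex_aff_dim[OF that cut[OF that]] dim by (simp add: \<psi>_def)
  have vcut: "c v \<bullet> v < \<beta> v" if "v \<in> cut_vertices" for v using cut[OF that] by (simp add: cuts_off_def)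
  have "inj_on \<phi> full_facets"
  proof (rule inj_onI)
    fix F G assume FG: "F \<in> full_facets" "G \<in> full_facets" "\<phi> F = \<phi> G"
    have "\<phi> F \<subseteq> F \<inter> G" using FG(3) by (auto simp: \<phi>_def)
    then have "aff_dim P - 1 \<le> aff_dim (F \<inter> G)"
      using aff_dim_subset[of "\<phi> F" "F \<inter> G"] full_facet_aff_dim[OF FG(1)] dim by (simp add: \<phi>_def)
    then show "F = G" using FG polytope_imp_convex[OF poly] by (intro facets_eqI) (auto simp: full_facets_def)
  qed
  moreover have "inj_on \<psi> cut_vertices"
  proof (rule inj_onI, rule ccontr)
    fix v w assume vw: "v \<in> cut_vertices" "w \<in> cut_vertices" "\<psi> v = \<psi> w" "v \<noteq> w"
    obtain s where s: "s \<in> S" "c v \<bullet> s > \<beta> v" using outside[OF vw(1)] by blast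
    have gt: "c w \<bullet> v > \<beta> w" using cut_vertices_other_side[OF vw(2,1) _ cut[OF vw(2)]] vw(4) by auto
    have "c w \<bullet> v = \<beta> w"
    proof (rule hyperplane_supporting_both_sides(1)[OF affine_affine_hull \<psi>A \<psi>ne[OF vw(1)] \<psi>dim[OF vw(1)]])
      show "c v \<bullet> x = \<beta> v" if "x \<in> \<psi> v" for x using that by (simp add: \<psi>_def)
      show "c w \<bullet> x = \<beta> w" if "x \<in> \<psi> v" for x using that unfolding vw(3) by (simp add: \<psi>_def)
      show "c w \<bullet> s \<ge> \<beta> w" using hull_side(1)[OF vw(2) cut[OF vw(2)] s(1)] .
    qed (use gt s inA inP vw vcut in auto)
    then show False using gt by simp
  qed
  moreover have "\<phi> ` full_facets \<inter> \<psi> ` cut_vertices = {}"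
  proof (rule ccontr)
    assume "\<not> ?thesis"
    then obtain F v where F: "F \<in> full_facets" and v: "v \<in> cut_vertices" and eq: "\<phi> F = \<psi> v" by blast
    have "F facet_of P" using F by (simp add: full_facets_def facets_def)
    then obtain a b where ab: "P \<subseteq> {x. a \<bullet> x \<le> b}" "F = P \<inter> {x. a \<bullet> x = b}"
      by (rule facet_of_polyhedron[OF polytope_imp_polyhedron[OF poly]])
    obtain s where s: "s \<in> S" "c v \<bullet> s > \<beta> v" using outside[OF v] by blast
    \<comment> \<open>The facet hyperplane of \<open>F\<close> is negated to match the direction of
      the inequalities. It then contains \<open>s\<close>, which puts \<open>s\<close> into
      \<open>\<phi> F = \<psi> v\<close> although \<open>s\<close> lies strictly beyond the cutting
      hyperplane.\<close>
    have "(- a) \<bullet> s = - b"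
    proof (rule hyperplane_supporting_both_sides(2)[OF affine_affine_hull \<psi>A \<psi>ne[OF v] \<psi>dim[OF v]])
      show "c v \<bullet> x = \<beta> v" if "x \<in> \<psi> v" for x using that by (simp add: \<psi>_def)
      show "(- a) \<bullet> x = - b" if "x \<in> \<psi> v" for x using that ab(2) unfolding eq[symmetric] by (simp add: \<phi>_def)
      show "- b \<le> (- a) \<bullet> s" "- b \<le> (- a) \<bullet> v" using ab(1) inP s v by auto
    qed (use s v inA inP vcut in auto)
    then have "s \<in> \<phi> F" using ab(2) inP s(1) hull_inc[of s S convex] by (simp add: \<phi>_def)
    then show False using s(2) unfolding eq by (simp add: \<psi>_def)
  qed
  ultimately have "card full_facets + card cut_vertices = card (\<phi> ` full_facets \<union> \<psi> ` cut_vertices)"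
    using fin_full fin_cut by (simp add: card_Un_disjoint card_image)
  also have "\<dots> \<le> card (facets ?Q)"
    using \<phi> \<psi> finite_polytope_facets[OF polytope_convex_hull[OF finS]] by (intro card_mono) (auto simp: facets_def)
  finally show ?thesis .
qed

text \<open>When \<open>Q\<close> is not full-dimensional, distinct counted objects may yield the same face of \<open>Q\<close> (as for
  a simplex, or the two opposite vertices of a quadrilateral), but then at most two objects are counted.\<close>

lemma card_facets_hull_low_dim:
  assumes low: "aff_dim (convex hull S) < int d"
  shows "card full_facets + card cut_vertices \<le> card (facets (convex hull S))"
proof (cases "full_facets = {} \<and> cut_vertices = {}")
  case True
  then show ?thesis by simp
next
  case False
  note aff_dim_convex_hull[simp]
  let ?Q = "convex hull S"
  have "int d - 1 \<le> aff_dim ?Q"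
  proof -
    consider F where "F \<in> full_facets" | v where "v \<in> cut_vertices" using False by blast
    then show ?thesis
    proof cases
      case 1
      then show ?thesis using full_facet_aff_dim[of F] aff_dim_subset[of "?Q \<inter> F" ?Q] by simp
    next
      case 2
      then have "aff_dim (adj_vertices P v) \<le> aff_dim S" by (intro aff_dim_subset) (auto simp: cut_vertices_def)
      then show ?thesis using aff_dim_adj 2 by (simp add: cut_vertices_def)
    qed
  qed
  \<comment> \<open>The hull has dimension at least \<open>d - 1 \<ge> 1\<close>, so it has two
    facets; it remains to see that at most two objects are counted.\<close>
  then have two: "2 \<le> card (facets ?Q)"
    using d2 polytope_convex_hull[OF finS] by (intro polytope_facets_ge_2) auto
  \<comment> \<open>\<open>?Q \<inter> F\<close> already has the dimension of \<open>?Q\<close>, so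
    \<open>?Q\<close> lies in the affine hull of \<open>F\<close>, which meets \<open>P\<close> only
    in \<open>F\<close>.\<close>
  have inF: "S \<subseteq> F" if F: "F \<in> full_facets" for F
  proof -
    have FP: "F face_of P" using F by (simp add: full_facets_def facets_def facet_of_def)
    have "?Q \<inter> F \<noteq> {}" using full_facet_aff_dim[OF F] d2 by auto
    then have "?Q \<subseteq> affine hull (?Q \<inter> F)"
      using full_facet_aff_dim[OF F] low by (intro affine_hull_eq_of_aff_dim_le) auto
    also have "\<dots> \<subseteq> affine hull F" by (intro hull_mono) auto
    finally have "?Q \<subseteq> affine hull F \<inter> P" using hull_subset_P by blast
    also have "\<dots> = F" using face_of_imp_eq_affine_Int[OF polytope_imp_convex[OF poly] FP] by simp
    finally show ?thesis using hull_subset[of S convex] by blast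
  qed
  \<comment> \<open>For the same reason \<open>S\<close> lies in the cutting hyperplane of
    \<open>v\<close>, and the only vertices there are the neighbours.\<close>
  have SN: "S = adj_vertices P v" if v: "v \<in> cut_vertices" for v
  proof -
    have vV: "v \<in> vertices P" using v by (simp add: cut_vertices_def)
    have sub: "adj_vertices P v \<subseteq> S" using v by (simp add: cut_vertices_def)
    have "adj_vertices P v \<noteq> {}" using card_adj[OF vV] d2 by auto
    then have hull: "S \<subseteq> affine hull (adj_vertices P v)"
      using low aff_dim_adj[OF vV] sub by (intro affine_hull_eq_of_aff_dim_le) auto
    obtain c \<beta> where c: "cuts_off P v c \<beta>" using cuts_off_exists[OF vV] by blast
    have "affine hull (adj_vertices P v) \<subseteq> {x. c \<bullet> x = \<beta>}"
      using c by (intro hull_minimal affine_hyperplane) (auto simp: cuts_off_def)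
    then have "c \<bullet> s = \<beta>" if "s \<in> S" for s using hull that by blast
    then have "S \<subseteq> adj_vertices P v"
      using c S v unfolding cuts_off_def cut_vertices_def by (metis DiffD2 less_irrefl mem_Collect_eq subsetD subsetI)
    then show ?thesis using sub by blast
  qed
  have "card full_facets \<le> Suc 0"
  proof (subst card_le_Suc0_iff_eq[OF fin_full], intro ballI)
    fix F G assume FG: "F \<in> full_facets" "G \<in> full_facets"
    have "?Q \<subseteq> F" if "F \<in> full_facets" for F
      using inF[OF that] facet_convex[of F] that by (intro hull_minimal) (simp_all add: full_facets_def)
    with FG have "aff_dim ?Q \<le> aff_dim (F \<inter> G)" by (intro aff_dim_subset) auto
    then show "F = G" using FG polytope_imp_convex[OF poly] \<open>int d - 1 \<le> aff_dim ?Q\<close> dim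
      by (intro facets_eqI[of P]) (auto simp: full_facets_def)
  qed
  have inA: "x \<in> affine hull P" if "x \<in> vertices P" for x
    using that vertices_subset by (intro hull_inc) auto
  have Sdim: "aff_dim (affine hull P) \<le> aff_dim S + 1" "S \<noteq> {}"
    using \<open>int d - 1 \<le> aff_dim ?Q\<close> dim d2 by auto
  have SA: "S \<subseteq> affine hull P" using S inA by auto
  show ?thesis
  proof (cases "\<exists>v w. v \<in> cut_vertices \<and> w \<in> cut_vertices \<and> v \<noteq> w")
    case False
    then have "card cut_vertices \<le> Suc 0" by (subst card_le_Suc0_iff_eq[OF fin_cut]) blast
    then show ?thesis using \<open>card full_facets \<le> Suc 0\<close> two by simp
  next
    case True
    then obtain v w where vw: "v \<in> cut_vertices" "w \<in> cut_vertices" "v \<noteq> w" by blast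
    have V: "v \<in> vertices P" "w \<in> vertices P" using vw by (auto simp: cut_vertices_def)
    obtain c \<beta> where c: "cuts_off P v c \<beta>" using cuts_off_exists[OF V(1)] by blast
    have cS: "c \<bullet> x = \<beta>" if "x \<in> S" for x using c that SN[OF vw(1)] by (simp add: cuts_off_def)
    have cv: "c \<bullet> v < \<beta>" using c by (simp add: cuts_off_def)
    have cw: "c \<bullet> w > \<beta>" using cut_vertices_other_side[OF vw c] .
    \<comment> \<open>The cut vertices \<open>v\<close> and \<open>w\<close> lie on opposite sides
      of the hyperplane of \<open>S\<close>. A facet containing \<open>S\<close> would therefore
      also contain \<open>v\<close>, hence \<open>d + 1\<close> affinely independent points.\<close>
    have "full_facets = {}"
    proof (rule ccontr)
      assume "full_facets \<noteq> {}"
      then obtain F where F: "F \<in> full_facets" by blast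
      have "F facet_of P" using F by (simp add: full_facets_def facets_def)
      then obtain a b where ab: "P \<subseteq> {x. a \<bullet> x \<le> b}" "F = P \<inter> {x. a \<bullet> x = b}"
        by (rule facet_of_polyhedron[OF polytope_imp_polyhedron[OF poly]])
      have "(- a) \<bullet> v = - b"
      proof (rule hyperplane_supporting_both_sides(1)[OF affine_affine_hull SA Sdim(2,1) cS])
        show "(- a) \<bullet> x = - b" if "x \<in> S" for x using that inF[OF F] ab(2) by auto
        show "- b \<le> (- a) \<bullet> v" "- b \<le> (- a) \<bullet> w" using ab(1) V vertices_subset by auto
      qed (use V inA cv cw in auto)
      then have "v \<in> F" using ab(2) V vertices_subset by auto
      then have "insert v (adj_vertices P v) \<subseteq> F" using inF[OF F] SN[OF vw(1)] by simp
      from aff_dim_subset[OF this] show False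
        using aff_dim_insert_adj[OF V(1)] facet_aff_dim[of F] F by (simp add: full_facets_def)
    qed
    \<comment> \<open>The cutting hyperplane of a third cut vertex would contain \<open>S\<close>
      and have \<open>v\<close> and \<open>w\<close> strictly on the same side.\<close>
    moreover have "cut_vertices \<subseteq> {v, w}"
    proof
      fix u assume u: "u \<in> cut_vertices"
      show "u \<in> {v, w}"
      proof (rule ccontr)
        assume nu: "u \<notin> {v, w}"
        obtain c' \<beta>' where c': "cuts_off P u c' \<beta>'"
          using cuts_off_exists[of u] u by (auto simp: cut_vertices_def)
        have gt: "c' \<bullet> v > \<beta>'" "c' \<bullet> w > \<beta>'" using cut_vertices_other_side[OF u _ _ c'] vw nu by auto
        have "c' \<bullet> v = \<beta>'"
        proof (rule hyperplane_supporting_both_sides(1)[OF affine_affine_hull SA Sdim(2,1) cS])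
          show "c' \<bullet> x = \<beta>'" if "x \<in> S" for x using c' that SN[OF u] by (simp add: cuts_off_def)
        qed (use V inA cv cw gt in auto)
        then show False using gt by simp
      qed
    qed
    then have "card cut_vertices \<le> card {v, w}" by (intro card_mono) auto
    then have "card cut_vertices \<le> 2" by (simp add: card_insert_if split: if_splits)
    ultimately show ?thesis using two by simp
  qed
qed

lemma card_facets_hull_ge: "card full_facets + card cut_vertices \<le> card (facets (convex hull S))"
proof -
  have "aff_dim (convex hull S) \<le> int d" using aff_dim_subset[OF hull_subset_P] dim by simp
  then show ?thesis using card_facets_hull_full_dim card_facets_hull_low_dim by linarith
qed

end

end

section \<open>Bounded differences\<close>

lemma finite_set_Pi_pmf:
  assumes "finite A" "\<And>x. x \<in> A \<Longrightarrow> finite (set_pmf (p x))"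
  shows "finite (set_pmf (Pi_pmf A dflt p))"
  using assms by (simp add: set_Pi_pmf finite_PiE_dflt)

text \<open>Fubini for one coordinate; finite supports turn the integrals into finite sums.\<close>

lemma expectation_Pi_pmf_insert:
  fixes h :: "('a \<Rightarrow> 'b) \<Rightarrow> real"
  assumes "finite A" "x \<notin> A" "\<And>y. y \<in> insert x A \<Longrightarrow> finite (set_pmf (p y))"
  shows "measure_pmf.expectation (Pi_pmf (insert x A) dflt p) h =
    measure_pmf.expectation (p x) (\<lambda>y. measure_pmf.expectation (Pi_pmf A dflt p) (\<lambda>g. h (g(x := y))))"
proof -
  have fin: "finite (set_pmf (Pi_pmf A dflt p))" using assms by (intro finite_set_Pi_pmf) auto
  have "Pi_pmf (insert x A) dflt p = p x \<bind> (\<lambda>y. map_pmf (\<lambda>g. g(x := y)) (Pi_pmf A dflt p))"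
    using assms by (simp add: Pi_pmf_insert' map_pmf_def)
  also have "measure_pmf.expectation \<dots> h =
      (\<Sum>y\<in>set_pmf (p x). pmf (p x) y *\<^sub>R measure_pmf.expectation (Pi_pmf A dflt p) (\<lambda>g. h (g(x := y))))"
    using assms fin by (subst pmf_expectation_bind[of "set_pmf (p x)"]) auto
  also have "\<dots> = measure_pmf.expectation (p x) (\<lambda>y. measure_pmf.expectation (Pi_pmf A dflt p) (\<lambda>g. h (g(x := y))))"
    using assms by (subst integral_measure_pmf[of "set_pmf (p x)"]) auto
  finally show ?thesis .
qed

text \<open>On the support \<open>h\<close> ranges between its minimum and maximum, at distance at
  most \<open>c\<close>. Stating Hoeffding's lemma through the oscillation of \<open>h\<close> suits
  conditional expectations, of which only differences are controlled.\<close>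

lemma Hoeffdings_lemma_pmf_finite:
  fixes h :: "'b \<Rightarrow> real"
  assumes fin: "finite (set_pmf M)" and l: "l > 0"
    and c: "\<And>y z. y \<in> set_pmf M \<Longrightarrow> z \<in> set_pmf M \<Longrightarrow> \<bar>h y - h z\<bar> \<le> c"
  shows "measure_pmf.expectation M (\<lambda>y. exp (l * (h y - measure_pmf.expectation M h))) \<le> exp (l\<^sup>2 * c\<^sup>2 / 8)"
proof -
  define a where "a = Min (h ` set_pmf M)"
  define b where "b = Max (h ` set_pmf M)"
  interpret interval_bounded_random_variable "measure_pmf M" h a b
    by unfold_locales (auto simp: AE_measure_pmf_iff a_def b_def fin)
  have ne: "h ` set_pmf M \<noteq> {}" by (simp add: set_pmf_not_empty)
  have "a \<in> h ` set_pmf M" "b \<in> h ` set_pmf M" using fin ne by (auto simp: a_def b_def)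
  then have "\<bar>b - a\<bar> \<le> c" using c by auto
  then have ba: "(b - a)\<^sup>2 \<le> c\<^sup>2" by (simp add: abs_le_square_iff[symmetric])
  have "ennreal (measure_pmf.expectation M (\<lambda>y. exp (l * (h y - measure_pmf.expectation M h)))) =
      (\<integral>\<^sup>+y. ennreal (exp (l * (h y - measure_pmf.expectation M h))) \<partial>measure_pmf M)"
    using fin by (subst nn_integral_eq_integral) (auto simp: integrable_measure_pmf_finite)
  also have "\<dots> \<le> ennreal (exp (l\<^sup>2 * (b - a)\<^sup>2 / 8))"
    by (rule Hoeffdings_lemma_nn_integral[OF l])
  finally have "measure_pmf.expectation M (\<lambda>y. exp (l * (h y - measure_pmf.expectation M h))) \<le> exp (l\<^sup>2 * (b - a)\<^sup>2 / 8)"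
    by simp
  also have "\<dots> \<le> exp (l\<^sup>2 * c\<^sup>2 / 8)"
    using mult_left_mono[OF ba, of "l\<^sup>2"] by simp
  finally show ?thesis .
qed

text \<open>Induction over the coordinates replaces the martingale. With \<open>h y\<close> the
  expectation given value \<open>y\<close> at \<open>x\<close>, split \<open>f - \<mu>\<close> into
  \<open>f - h y\<close> and \<open>h y - \<mu>\<close>: the first is covered by the induction
  hypothesis, the second by Hoeffding's lemma, since \<open>h\<close> oscillates by at most
  \<open>c x\<close>.\<close>

lemma bounded_differences_mgf:
  fixes f :: "('a \<Rightarrow> 'b) \<Rightarrow> real"
  assumes "finite A" "\<And>x. x \<in> A \<Longrightarrow> finite (set_pmf (p x))" and l: "l > 0"
    and "\<And>x g y z. x \<in> A \<Longrightarrow> \<bar>f (g(x := y)) - f (g(x := z))\<bar> \<le> c x"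
  shows "measure_pmf.expectation (Pi_pmf A dflt p) (\<lambda>g. exp (l * (f g - measure_pmf.expectation (Pi_pmf A dflt p) f)))
           \<le> exp (l\<^sup>2 * (\<Sum>x\<in>A. (c x)\<^sup>2) / 8)"
  using assms(1,2,4)
proof (induction A arbitrary: f rule: finite_induct)
  case empty
  then show ?case by simp
next
  case (insert x A)
  let ?M = "Pi_pmf A dflt p"
  define h where "h y = measure_pmf.expectation ?M (\<lambda>g. f (g(x := y)))" for y
  define \<mu> where "\<mu> = measure_pmf.expectation (p x) h"
  define K where "K = exp (l\<^sup>2 * (\<Sum>x\<in>A. (c x)\<^sup>2) / 8)"
  have fin: "finite (set_pmf ?M)" using insert by (intro finite_set_Pi_pmf) auto
  have finx: "finite (set_pmf (p x))" using insert by auto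
  note int = integrable_measure_pmf_finite[OF fin] and intx = integrable_measure_pmf_finite[OF finx]
  have inner: "measure_pmf.expectation ?M (\<lambda>g. exp (l * (f (g(x := y)) - h y))) \<le> K" for y
    unfolding K_def h_def
  proof (rule insert.IH)
    show "\<bar>f ((g(x' := u))(x := y)) - f ((g(x' := w))(x := y))\<bar> \<le> c x'" if "x' \<in> A" for x' g u w
      using insert.prems(2)[of x' "g(x := y)" u w] that insert.hyps(2)
      by (metis fun_upd_twist insertCI)
  qed (use insert in auto)
  have diff: "\<bar>h y - h z\<bar> \<le> c x" for y z
  proof -
    have "\<bar>h y - h z\<bar> = \<bar>measure_pmf.expectation ?M (\<lambda>g. f (g(x := y)) - f (g(x := z)))\<bar>"
      unfolding h_def by (subst Bochner_Integration.integral_diff) (auto intro: int)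
    also have "\<dots> \<le> measure_pmf.expectation ?M (\<lambda>g. \<bar>f (g(x := y)) - f (g(x := z))\<bar>)"
      by (rule integral_abs_bound)
    also have "\<dots> \<le> measure_pmf.expectation ?M (\<lambda>g. c x)"
      by (intro integral_mono int insert.prems(2) insertI1)
    finally show ?thesis by simp
  qed
  have "measure_pmf.expectation (Pi_pmf (insert x A) dflt p) f = \<mu>"
    unfolding \<mu>_def h_def using insert by (intro expectation_Pi_pmf_insert) auto
  then have "measure_pmf.expectation (Pi_pmf (insert x A) dflt p) (\<lambda>g. exp (l * (f g - measure_pmf.expectation (Pi_pmf (insert x A) dflt p) f))) =
    measure_pmf.expectation (p x) (\<lambda>y. measure_pmf.expectation ?M (\<lambda>g. exp (l * (f (g(x := y)) - \<mu>))))"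
    using insert by (subst expectation_Pi_pmf_insert) auto
  also have "\<dots> \<le> measure_pmf.expectation (p x) (\<lambda>y. exp (l * (h y - \<mu>)) * K)"
  proof (intro integral_mono intx)
    fix y
    have "(\<lambda>g. exp (l * (f (g(x := y)) - \<mu>))) = (\<lambda>g. exp (l * (h y - \<mu>)) * exp (l * (f (g(x := y)) - h y)))"
      by (simp add: exp_add[symmetric] algebra_simps)
    then show "measure_pmf.expectation ?M (\<lambda>g. exp (l * (f (g(x := y)) - \<mu>))) \<le> exp (l * (h y - \<mu>)) * K"
      using inner[of y] by simp
  qed
  also have "\<dots> = measure_pmf.expectation (p x) (\<lambda>y. exp (l * (h y - \<mu>))) * K" by simp
  also have "\<dots> \<le> exp (l\<^sup>2 * (c x)\<^sup>2 / 8) * K"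
    unfolding \<mu>_def using diff by (intro mult_right_mono Hoeffdings_lemma_pmf_finite finx l) (auto simp: K_def)
  also have "\<dots> = exp (l\<^sup>2 * (\<Sum>x\<in>insert x A. (c x)\<^sup>2) / 8)"
    using insert.hyps by (simp add: K_def exp_add[symmetric] algebra_simps add_divide_distrib)
  finally show ?case .
qed

text \<open>Exponential Markov inequality for \<open>- f\<close>, with the moment generating
  function bounded by the preceding lemma.\<close>

lemma McDiarmid_lower_tail:
  fixes f :: "('a \<Rightarrow> 'b) \<Rightarrow> real"
  assumes A: "finite A" "\<And>x. x \<in> A \<Longrightarrow> finite (set_pmf (p x))"
    and diff: "\<And>x g y z. x \<in> A \<Longrightarrow> \<bar>f (g(x := y)) - f (g(x := z))\<bar> \<le> c x"
    and t: "t > 0" and C: "(\<Sum>x\<in>A. (c x)\<^sup>2) \<le> C" "C > 0"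
  shows "measure_pmf.prob (Pi_pmf A dflt p) {g. f g \<le> measure_pmf.expectation (Pi_pmf A dflt p) f - t}
           \<le> exp (- (2 * t\<^sup>2 / C))"
proof -
  let ?M = "Pi_pmf A dflt p"
  define \<mu> where "\<mu> = measure_pmf.expectation ?M f"
  \<comment> \<open>The minimiser of \<open>- l * t + l\<^sup>2 * C / 8\<close>, with minimum
    \<open>- 2 * t\<^sup>2 / C\<close>.\<close>
  define l where "l = 4 * t / C"
  have l: "l > 0" using t C by (simp add: l_def)
  note int = integrable_measure_pmf_finite[OF finite_set_Pi_pmf[OF A]]
  let ?E = "measure_pmf.expectation ?M (\<lambda>g. exp (l * (- f g - measure_pmf.expectation ?M (\<lambda>g. - f g))))"
  have "measure_pmf.prob ?M {g. f g \<le> \<mu> - t} = measure_pmf.expectation ?M (indicator {g. f g \<le> \<mu> - t})"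
    by simp
  also have "\<dots> \<le> measure_pmf.expectation ?M (\<lambda>g. exp (- (l * t)) * exp (l * (- f g - measure_pmf.expectation ?M (\<lambda>g. - f g))))"
  proof (intro integral_mono int)
    fix g
    show "indicator {g. f g \<le> \<mu> - t} g \<le> exp (- (l * t)) * exp (l * (- f g - measure_pmf.expectation ?M (\<lambda>g. - f g)))"
    proof (cases "f g \<le> \<mu> - t")
      case True
      then have "0 \<le> l * (\<mu> - f g - t)" using l by simp
      then have "0 \<le> - (l * t) + l * (- f g - measure_pmf.expectation ?M (\<lambda>g. - f g))"
        by (simp add: \<mu>_def algebra_simps)
      then show ?thesis using True by (simp add: exp_add[symmetric])
    qed simp
  qed
  also have "\<dots> = exp (- (l * t)) * ?E" by simp
  also have "\<dots> \<le> exp (- (l * t)) * exp (l\<^sup>2 * (\<Sum>x\<in>A. (c x)\<^sup>2) / 8)"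
    using diff by (intro mult_left_mono bounded_differences_mgf A l) (auto simp: abs_minus_commute)
  also have "\<dots> \<le> exp (- (l * t)) * exp (l\<^sup>2 * C / 8)"
    using C by (intro mult_left_mono) (auto intro: mult_left_mono)
  also have "\<dots> = exp (- (2 * t\<^sup>2 / C))"
    using C by (simp add: exp_add[symmetric] l_def power2_eq_square field_simps)
  finally show ?thesis by (simp add: \<mu>_def)
qed

section \<open>Random subpolytopes\<close>

lemma prob_Pi_pmf_bernoulli:
  assumes "finite V" "B \<subseteq> V" "D \<subseteq> V" "B \<inter> D = {}" "0 \<le> p" "p \<le> (1::real)"
  shows "measure_pmf.prob (Pi_pmf V False (\<lambda>_. bernoulli_pmf p)) {g. (\<forall>v\<in>B. g v) \<and> (\<forall>v\<in>D. \<not> g v)}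
           = p ^ card B * (1 - p) ^ card D"
proof -
  let ?T = "\<lambda>v. if v \<in> B then {True} else if v \<in> D then {False} else UNIV"
  have pr: "measure_pmf.prob (bernoulli_pmf p) {b} = (if b then p else 1 - p)" for b
    using assms by (cases b) (simp_all add: measure_pmf_single)
  have "{g. (\<forall>v\<in>B. g v) \<and> (\<forall>v\<in>D. \<not> g v)} = Pi V ?T"
    using assms by (auto simp: Pi_def split: if_splits)
  then have "measure_pmf.prob (Pi_pmf V False (\<lambda>_. bernoulli_pmf p)) {g. (\<forall>v\<in>B. g v) \<and> (\<forall>v\<in>D. \<not> g v)}
      = (\<Prod>v\<in>V. measure_pmf.prob (bernoulli_pmf p) (?T v))"
    using measure_Pi_pmf_Pi[OF assms(1)] by simp
  \<comment> \<open>Disjointness of \<open>B\<close> and \<open>D\<close> lets each factor split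
    into an inclusion part and an exclusion part.\<close>
  also have "\<dots> = (\<Prod>v\<in>V. (if v \<in> B then p else 1) * (if v \<in> D then 1 - p else 1))"
    using assms(4) by (intro prod.cong) (auto simp: pr)
  also have "\<dots> = p ^ card B * (1 - p) ^ card D"
    using assms(1-3) by (simp add: prod.distrib prod.If_cases Int_absorb1)
  finally show ?thesis .
qed

section \<open>The weighted lower count of facets\<close>

context simple_polytope
begin

text \<open>Spreading the contribution of a facet evenly over its vertices, instead of choosing one centre
  per facet, makes every vertex carry total weight at most 1 because a facet has at least \<open>d\<close>
  vertices and a vertex lies on exactly \<open>d\<close> facets.\<close>

definition facet_weight :: "'a set \<Rightarrow> real" where
  "facet_weight F = 1 / real (card (vertices P \<inter> F))"

definition star_count :: "'a set \<Rightarrow> 'a \<Rightarrow> real" where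
  "star_count S v = (\<Sum>F | F \<in> facets P \<and> v \<in> F. if insert v (adj_vertices P v \<inter> F) \<subseteq> S then facet_weight F else 0)"

definition cut_count :: "'a set \<Rightarrow> 'a \<Rightarrow> real" where
  "cut_count S v = (if v \<notin> S \<and> adj_vertices P v \<subseteq> S then 1 else 0)"

definition facet_count :: "'a set \<Rightarrow> real" where
  "facet_count S = (\<Sum>v\<in>vertices P. star_count S v + cut_count S v)"

text \<open>The value of \<open>star_count\<close> at a vertex when every vertex is included; called
  \<open>e_x\<close> in the overview.\<close>

definition vertex_weight :: "'a \<Rightarrow> real" where
  "vertex_weight v = (\<Sum>F | F \<in> facets P \<and> v \<in> F. facet_weight F)"

lemma facet_weight_nonneg: "facet_weight F \<ge> 0"
  by (simp add: facet_weight_def)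

lemma facet_has_vertex:
  assumes "F \<in> facets P"
  shows "vertices P \<inter> F \<noteq> {}"
proof -
  have F: "F face_of P" "F \<noteq> {}" using assms by (auto simp: facets_def facet_of_def)
  have "compact F" using face_of_imp_compact F poly polytope_imp_compact polytope_imp_convex by blast
  then obtain x where "x extreme_point_of F" using extreme_point_exists_convex face_of_imp_convex F by blast
  then show ?thesis using extreme_point_of_face[OF F(1)] by (auto simp: vertices_def)
qed

lemma sum_facet_weight:
  assumes "F \<in> facets P"
  shows "(\<Sum>v\<in>vertices P \<inter> F. facet_weight F) = 1"
  using facet_has_vertex[OF assms] fin_vertices by (simp add: facet_weight_def)

text \<open>\<open>F\<close> contains a star at \<open>v\<close>, hence at least \<open>d\<close>
  vertices.\<close>

lemma facet_weight_le:
  assumes "v \<in> vertices P" "F \<in> facets P" "v \<in> F"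
  shows "facet_weight F \<le> 1 / real d"
proof -
  have "card (insert v (adj_vertices P v \<inter> F)) \<le> card (vertices P \<inter> F)"
    using assms adj_vertices_subset fin_vertices by (intro card_mono) auto
  then have "d \<le> card (vertices P \<inter> F)" using card_star[OF assms] by simp
  then show ?thesis unfolding facet_weight_def using d2 by (intro divide_left_mono) auto
qed

lemma vertex_weight_nonneg: "vertex_weight v \<ge> 0"
  unfolding vertex_weight_def by (intro sum_nonneg facet_weight_nonneg)

lemma vertex_weight_le_1:
  assumes "v \<in> vertices P"
  shows "vertex_weight v \<le> 1"
proof -
  have "vertex_weight v \<le> real (card {F. F \<in> facets P \<and> v \<in> F}) * (1 / real d)"
    unfolding vertex_weight_def using facet_weight_le[OF assms] by (intro sum_bounded_above) auto
  then show ?thesis using facets_at[OF assms] d2 by simp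
qed

lemma sum_vertices_facets_swap:
  "(\<Sum>v\<in>vertices P. \<Sum>F | F \<in> facets P \<and> v \<in> F. h v F) = (\<Sum>F\<in>facets P. \<Sum>v\<in>vertices P \<inter> F. h v F :: real)"
  using sum.swap_restrict[OF fin_vertices fin_facets, of h "\<lambda>v F. v \<in> F"] by (simp add: Int_def)

lemma sum_vertex_weight: "(\<Sum>v\<in>vertices P. vertex_weight v) = real (card (facets P))"
  unfolding vertex_weight_def sum_vertices_facets_swap using sum_facet_weight by simp

lemma star_count_nonneg: "0 \<le> star_count S v"
  unfolding star_count_def using facet_weight_nonneg by (intro sum_nonneg) auto

lemma star_count_le: "star_count S v \<le> vertex_weight v"
  unfolding star_count_def vertex_weight_def using facet_weight_nonneg by (intro sum_mono) auto

lemma star_count_mono: "S \<subseteq> T \<Longrightarrow> star_count S v \<le> star_count T v"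
  unfolding star_count_def using facet_weight_nonneg by (intro sum_mono) auto

lemma star_count_eq_0: "v \<notin> S \<Longrightarrow> star_count S v = 0"
  by (simp add: star_count_def)

text \<open>Exchanging the sums, a facet contributes the proportion of its vertices whose star in it
  is included: at most 1, and 0 unless the facet is full. Cut vertices are counted exactly.\<close>

lemma facet_count_le_card_facets:
  assumes S: "S \<subseteq> vertices P"
  shows "facet_count S \<le> real (card (facets (convex hull S)))"
proof -
  have "(\<Sum>v\<in>vertices P. cut_count S v) = real (card (cut_vertices S))"
  proof -
    have "(\<Sum>v\<in>vertices P. cut_count S v) = (\<Sum>v\<in>cut_vertices S. 1)"
      unfolding cut_count_def using fin_vertices
      by (intro sum.mono_neutral_cong_right) (auto simp: cut_vertices_def[OF S])
    then show ?thesis by simp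
  qed
  moreover have "(\<Sum>v\<in>vertices P. star_count S v) \<le> real (card (full_facets S))"
  proof -
    have "(\<Sum>v\<in>vertices P. star_count S v) = (\<Sum>F\<in>facets P. \<Sum>v\<in>vertices P \<inter> F.
        if insert v (adj_vertices P v \<inter> F) \<subseteq> S then facet_weight F else 0)"
      unfolding star_count_def by (rule sum_vertices_facets_swap)
    also have "\<dots> \<le> (\<Sum>F\<in>facets P. if F \<in> full_facets S then 1 else 0)"
    proof (rule sum_mono)
      fix F assume F: "F \<in> facets P"
      let ?s = "\<Sum>v\<in>vertices P \<inter> F. if insert v (adj_vertices P v \<inter> F) \<subseteq> S then facet_weight F else 0"
      show "?s \<le> (if F \<in> full_facets S then 1 else 0)"
      proof (cases "F \<in> full_facets S")
        case True
        have "?s \<le> (\<Sum>v\<in>vertices P \<inter> F. facet_weight F)" using facet_weight_nonneg by (intro sum_mono) auto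
        then show ?thesis using True sum_facet_weight[OF F] by simp
      next
        case False
        then have "?s = 0" using F by (intro sum.neutral) (auto simp: full_facets_def[OF S])
        then show ?thesis using False by simp
      qed
    qed
    also have "\<dots> = (\<Sum>F\<in>full_facets S. 1)"
      using fin_facets by (intro sum.mono_neutral_cong_right) (auto simp: full_facets_def[OF S])
    finally show ?thesis by simp
  qed
  ultimately have "facet_count S \<le> real (card (full_facets S) + card (cut_vertices S))"
    by (simp add: facet_count_def sum.distrib)
  also have "\<dots> \<le> real (card (facets (convex hull S)))"
    using card_facets_hull_ge[OF S] by (simp only: of_nat_le_iff)
  finally show ?thesis .
qed

text \<open>Only the terms of \<open>x\<close> and its \<open>d\<close> neighbours change. Each
  neighbour gains between 0 and 1, and \<open>x\<close> itself changes by between -1 and its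
  weight.\<close>

lemma facet_count_insert:
  assumes x: "x \<in> vertices P" "x \<notin> S"
  shows "\<bar>facet_count (insert x S) - facet_count S\<bar> \<le> real d + vertex_weight x"
proof -
  define \<delta> where "\<delta> v = star_count (insert x S) v + cut_count (insert x S) v - (star_count S v + cut_count S v)" for v
  have \<delta>0: "\<delta> v = 0" if "v \<noteq> x" "v \<notin> adj_vertices P x" for v
  proof -
    have "x \<notin> adj_vertices P v" using that adj_vertices_sym by blast
    then have "star_count (insert x S) v = star_count S v" "cut_count (insert x S) v = cut_count S v"
      using that unfolding star_count_def cut_count_def by (auto intro!: sum.cong simp: subset_insert)
    then show ?thesis by (simp add: \<delta>_def)
  qed
  \<comment> \<open>A neighbour of \<open>x\<close> contributes a star only if it is in \<open>S\<close> and a cut only if it is not, so it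
    gains at most 1 in total.\<close>
  have \<delta>1: "0 \<le> \<delta> v \<and> \<delta> v \<le> 1" if v: "v \<in> adj_vertices P x" for v
  proof -
    have xv: "x \<in> adj_vertices P v" and vx: "v \<noteq> x" using v adj_vertices_sym not_adj_self by blast+
    have vV: "v \<in> vertices P" using v adj_vertices_subset by blast
    have c0: "cut_count S v = 0" using xv x(2) by (auto simp: cut_count_def)
    show ?thesis
    proof (cases "v \<in> S")
      case True
      then show ?thesis
        using star_count_le[of "insert x S" v] vertex_weight_le_1[OF vV] star_count_nonneg[of S v]
          star_count_mono[of S "insert x S" v] c0 by (auto simp: \<delta>_def cut_count_def)
    next
      case False
      then show ?thesis using vx c0 by (simp add: \<delta>_def star_count_eq_0 cut_count_def)
    qed
  qed
  \<comment> \<open>Including \<open>x\<close> creates stars at \<open>x\<close>, of total at most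
    its weight, and may destroy the cut at \<open>x\<close>.\<close>
  have \<delta>x: "-1 \<le> \<delta> x \<and> \<delta> x \<le> vertex_weight x"
    using star_count_le[of "insert x S" x] star_count_nonneg[of "insert x S" x] star_count_eq_0[OF x(2)]
    by (auto simp: \<delta>_def cut_count_def)
  have "facet_count (insert x S) - facet_count S = (\<Sum>v\<in>vertices P. \<delta> v)"
    by (simp add: facet_count_def \<delta>_def sum_subtractf)
  also have "\<dots> = (\<Sum>v\<in>insert x (adj_vertices P x). \<delta> v)"
    using x adj_vertices_subset \<delta>0 fin_vertices by (intro sum.mono_neutral_right) auto
  also have "\<dots> = \<delta> x + (\<Sum>v\<in>adj_vertices P x. \<delta> v)"
    using not_adj_self finite_adj by simp
  finally have eq: "facet_count (insert x S) - facet_count S = \<delta> x + (\<Sum>v\<in>adj_vertices P x. \<delta> v)" .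
  have "0 \<le> (\<Sum>v\<in>adj_vertices P x. \<delta> v)" using \<delta>1 by (intro sum_nonneg) auto
  moreover have "(\<Sum>v\<in>adj_vertices P x. \<delta> v) \<le> real d"
    using sum_bounded_above[of "adj_vertices P x" \<delta> 1] \<delta>1 card_adj[OF x(1)] by simp
  ultimately show ?thesis using eq \<delta>x d2 vertex_weight_nonneg[of x] by auto
qed

section \<open>The count under independent inclusion\<close>

abbreviation "bern p \<equiv> Pi_pmf (vertices P) False (\<lambda>_. bernoulli_pmf p)"

abbreviation "included g \<equiv> {v \<in> vertices P. g v}"

lemma facet_count_bounded_difference:
  assumes x: "x \<in> vertices P"
  shows "\<bar>facet_count (included (g(x := y))) - facet_count (included (g(x := z)))\<bar> \<le> real d + vertex_weight x"
proof -
  let ?S = "included (g(x := False))"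
  have T: "included (g(x := True)) = insert x ?S" using x by auto
  have "x \<notin> ?S" by simp
  from facet_count_insert[OF x this] show ?thesis
    using vertex_weight_nonneg[of x] by (cases y; cases z) (auto simp only: T abs_minus_commute diff_self abs_zero)
qed

lemma finite_set_bern: "finite (set_pmf (bern p))"
  by (intro finite_set_Pi_pmf fin_vertices) simp

text \<open>By linearity: a star needs \<open>d\<close> included vertices, and a cut needs
  \<open>d\<close> included neighbours and one excluded vertex. The vertex weights sum to the number
  of facets.\<close>

lemma expectation_facet_count:
  assumes p: "0 \<le> p" "p \<le> 1"
  shows "measure_pmf.expectation (bern p) (\<lambda>g. facet_count (included g)) =
    p ^ d * real (card (facets P)) + real (card (vertices P)) * (1 - p) * p ^ d"
proof -
  note int = integrable_measure_pmf_finite[OF finite_set_bern[of p]]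
  have if_exp: "measure_pmf.expectation (bern p) (\<lambda>g. if Q g then w else 0) = w * measure_pmf.prob (bern p) {g. Q g}"
    for Q and w :: real
  proof -
    have "(\<lambda>g. if Q g then w else 0) = (\<lambda>g. w * indicator {g. Q g} g)" by auto
    then show ?thesis by simp
  qed
  have star: "measure_pmf.expectation (bern p) (\<lambda>g. star_count (included g) v) = vertex_weight v * p ^ d"
    if v: "v \<in> vertices P" for v
  proof -
    have "measure_pmf.expectation (bern p) (\<lambda>g. if insert v (adj_vertices P v \<inter> F) \<subseteq> included g then facet_weight F else 0)
        = facet_weight F * p ^ d" if F: "F \<in> facets P" "v \<in> F" for F
    proof -
      have sub: "insert v (adj_vertices P v \<inter> F) \<subseteq> vertices P" using v adj_vertices_subset by blast
      then have "{g. insert v (adj_vertices P v \<inter> F) \<subseteq> included g} =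
          {g. (\<forall>u\<in>insert v (adj_vertices P v \<inter> F). g u) \<and> (\<forall>u\<in>{}. \<not> g u)}" by auto
      then show ?thesis
        unfolding if_exp using prob_Pi_pmf_bernoulli[OF fin_vertices sub, of "{}" p] p card_star[OF v F] by simp
    qed
    then show ?thesis
      unfolding star_count_def vertex_weight_def sum_distrib_right
      by (subst Bochner_Integration.integral_sum) (auto intro: int)
  qed
  have cut: "measure_pmf.expectation (bern p) (\<lambda>g. cut_count (included g) v) = (1 - p) * p ^ d"
    if v: "v \<in> vertices P" for v
  proof -
    have sub: "adj_vertices P v \<subseteq> vertices P" by (rule adj_vertices_subset)
    then have "{g. v \<notin> included g \<and> adj_vertices P v \<subseteq> included g} =
        {g. (\<forall>u\<in>adj_vertices P v. g u) \<and> (\<forall>u\<in>{v}. \<not> g u)}" using v by auto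
    then show ?thesis
      unfolding cut_count_def if_exp
      using prob_Pi_pmf_bernoulli[OF fin_vertices sub, of "{v}" p] p card_adj[OF v] v not_adj_self by simp
  qed
  have "measure_pmf.expectation (bern p) (\<lambda>g. facet_count (included g)) =
      (\<Sum>v\<in>vertices P. vertex_weight v * p ^ d + (1 - p) * p ^ d)"
    unfolding facet_count_def using star cut by (simp add: Bochner_Integration.integral_sum int)
  also have "\<dots> = p ^ d * real (card (facets P)) + real (card (vertices P)) * (1 - p) * p ^ d"
    by (simp add: sum.distrib sum_distrib_right[symmetric] sum_vertex_weight)
  finally show ?thesis .
qed

text \<open>A weight in [0, 1] dominates its square, which makes the bound linear in the weights;
  their sum is the number of facets.\<close>

lemma sum_difference_bounds:
  "(\<Sum>x\<in>vertices P. (real d + vertex_weight x)\<^sup>2) \<le>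
     real (card (vertices P)) * (real d)\<^sup>2 + (2 * real d + 1) * real (card (facets P))"
proof -
  have "(\<Sum>x\<in>vertices P. (real d + vertex_weight x)\<^sup>2) \<le>
      (\<Sum>x\<in>vertices P. (real d)\<^sup>2 + (2 * real d + 1) * vertex_weight x)"
  proof (rule sum_mono)
    fix x assume x: "x \<in> vertices P"
    have "vertex_weight x * vertex_weight x \<le> 1 * vertex_weight x"
      using vertex_weight_le_1[OF x] vertex_weight_nonneg by (intro mult_right_mono) auto
    then show "(real d + vertex_weight x)\<^sup>2 \<le> (real d)\<^sup>2 + (2 * real d + 1) * vertex_weight x"
      by (simp add: power2_eq_square algebra_simps)
  qed
  also have "\<dots> = real (card (vertices P)) * (real d)\<^sup>2 + (2 * real d + 1) * real (card (facets P))"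
    by (simp add: sum.distrib sum_distrib_left[symmetric] sum_vertex_weight)
  finally show ?thesis .
qed

section \<open>Bounds for the random subpolytope\<close>

lemma random_subpolytope_conv_bern:
  "random_subpolytope P p = map_pmf (\<lambda>g. convex hull (included g)) (bern p)"
  by (simp add: random_subpolytope_def random_subset_def map_pmf_comp)

lemma expected_facets_ge:
  assumes p: "0 \<le> p" "p \<le> 1" and n: "n \<le> card (vertices P)"
  shows "p ^ d * real (card (facets P)) + real n * (1 - p) * p ^ d \<le>
    measure_pmf.expectation (random_subpolytope P p) (\<lambda>Q. real (card (facets Q)))"
proof -
  have "p ^ d * real (card (facets P)) + real n * (1 - p) * p ^ d \<le>
      measure_pmf.expectation (bern p) (\<lambda>g. facet_count (included g))"
    unfolding expectation_facet_count[OF p] using n p by (intro add_left_mono mult_right_mono) auto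
  also have "\<dots> \<le> measure_pmf.expectation (bern p) (\<lambda>g. real (card (facets (convex hull (included g)))))"
    by (intro integral_mono integrable_measure_pmf_finite finite_set_bern facet_count_le_card_facets) auto
  finally show ?thesis by (simp add: random_subpolytope_conv_bern)
qed

text \<open>McDiarmid's inequality for \<open>facet_count\<close> with deviation
  \<open>\<epsilon> * \<mu>\<close>, where \<open>\<mu>\<close> is its exact expectation over all
  \<open>N\<close> vertices; the bound then passes to the facets of the hull.\<close>

lemma facets_lower_tail:
  assumes p: "0 \<le> p" "p \<le> 1" and n: "n \<le> card (vertices P)" and \<epsilon>: "\<epsilon> > 0"
  shows "1 - exp (- 2 * (\<epsilon> * (1 - p) * p ^ d / real d)\<^sup>2 * real n) \<le>
    measure_pmf.prob (random_subpolytope P p)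
      {Q. real (card (facets Q)) \<ge> (1 - \<epsilon>) * (p ^ d * real (card (facets P)) + real n * (1 - p) * p ^ d)}"
    (is "_ \<le> measure_pmf.prob _ {Q. _ \<ge> (1 - \<epsilon>) * ?\<mu>n}")
\<comment> \<open>The degenerate cases: either the threshold is nonpositive and the event certain,
  or the exponent is 0 and the claimed bound is 0. Outside them \<open>\<mu>\<close> and
  \<open>C\<close> are positive.\<close>
proof (cases "\<epsilon> \<ge> 1 \<or> (1 - p) * p ^ d = 0 \<or> n = 0")
  case True
  then consider "\<epsilon> \<ge> 1" | "\<epsilon> * (1 - p) * p ^ d / real d = 0" | "n = 0" by auto
  then show ?thesis
  proof cases
    case 1
    have "(1 - \<epsilon>) * ?\<mu>n \<le> 0" using 1 p by (intro mult_nonpos_nonneg) auto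
    then have "{Q. real (card (facets Q)) \<ge> (1 - \<epsilon>) * ?\<mu>n} = (UNIV :: 'a set set)"
      by (auto intro: order_trans[of _ 0])
    then show ?thesis by (simp add: measure_pmf.prob_space[simplified])
  next
    case 2
    then show ?thesis by (simp only:) simp
  next
    case 3
    then show ?thesis by simp
  qed
next
  case False
  define N where "N = real (card (vertices P))"
  define m where "m = real (card (facets P))"
  define q where "q = 1 - p"
  define \<mu> where "\<mu> = p ^ d * m + N * q * p ^ d"
  define C where "C = N * (real d)\<^sup>2 + (2 * real d + 1) * m"
  have nz: "1 - p \<noteq> 0" "p ^ d \<noteq> 0" "n \<noteq> 0" and \<epsilon>1: "\<epsilon> < 1" using False by auto
  have q: "0 < q" "q \<le> 1" using nz(1) p unfolding q_def by linarith+
  have pd: "0 < p ^ d" using nz(2) zero_le_power[OF p(1), of d] by linarith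
  have nN: "real n \<le> N" and N: "N > 0" and m: "m \<ge> 0"
    using n nz(3) by (auto simp: N_def m_def)
  have \<mu>0: "\<mu> > 0" unfolding \<mu>_def using q pd N m by (intro add_nonneg_pos) auto
  have C0: "C > 0" unfolding C_def using N m d2 by (intro add_pos_nonneg) auto
  have E: "measure_pmf.expectation (bern p) (\<lambda>g. facet_count (included g)) = \<mu>"
    using expectation_facet_count[OF p] by (simp add: \<mu>_def N_def m_def q_def)
  \<comment> \<open>Replacing \<open>n\<close> by \<open>N\<close> only raises the threshold,
    because \<open>1 - \<epsilon>\<close> is positive.\<close>
  have \<mu>n: "(1 - \<epsilon>) * ?\<mu>n \<le> (1 - \<epsilon>) * \<mu>"
    unfolding \<mu>_def m_def[symmetric] q_def[symmetric]
    using \<epsilon>1 q pd nN by (intro mult_left_mono add_left_mono mult_right_mono) auto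
  \<comment> \<open>As \<open>\<mu> = p ^ d * (m + N * q)\<close>, this reduces to \<open>q\<^sup>2
    * N * C \<le> (real d)\<^sup>2 * (m + N * q)\<^sup>2\<close>. After expansion the
    \<open>N\<^sup>2\<close> terms agree, and the mixed terms compare by
    \<open>q * (2 * d + 1) \<le> 2 * d\<^sup>2\<close>. This uses \<open>q \<le> 1\<close> and
    \<open>d \<ge> 2\<close>; for \<open>d = 1\<close> and \<open>q = 1\<close> it fails.\<close>
  have exponent: "2 * (\<epsilon> * q * p ^ d / real d)\<^sup>2 * real n \<le> 2 * (\<epsilon> * \<mu>)\<^sup>2 / C"
  proof -
    have "2 * real d + 1 \<le> 2 * (real d)\<^sup>2"
    proof -
      have "2 * real d \<le> real d * real d" using d2 by (intro mult_right_mono) auto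
      moreover have "2 \<le> real d" using d2 by simp
      ultimately show ?thesis unfolding power2_eq_square by linarith
    qed
    then have "q * (2 * real d + 1) \<le> 1 * (2 * (real d)\<^sup>2)" using q by (intro mult_mono) auto
    then have "(q * N * m) * (q * (2 * real d + 1)) \<le> (q * N * m) * (2 * (real d)\<^sup>2)"
      using q N m by (intro mult_left_mono) auto
    then have "q\<^sup>2 * N * C \<le> (real d)\<^sup>2 * (m + N * q)\<^sup>2 - (real d)\<^sup>2 * m\<^sup>2"
      by (simp add: C_def power2_eq_square algebra_simps)
    then have "q\<^sup>2 * N * C \<le> (real d)\<^sup>2 * (m + N * q)\<^sup>2" by (rule order_trans) simp
    then have "q\<^sup>2 * N / (real d)\<^sup>2 \<le> (m + N * q)\<^sup>2 / C"
      using C0 d2 by (simp add: field_simps)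
    then have "2 * (\<epsilon> * p ^ d)\<^sup>2 * (q\<^sup>2 * N / (real d)\<^sup>2) \<le> 2 * (\<epsilon> * p ^ d)\<^sup>2 * ((m + N * q)\<^sup>2 / C)"
      by (intro mult_left_mono) auto
    moreover have "2 * (\<epsilon> * p ^ d)\<^sup>2 * ((m + N * q)\<^sup>2 / C) = 2 * (\<epsilon> * \<mu>)\<^sup>2 / C"
    proof -
      have "\<mu> = p ^ d * (m + N * q)" by (simp add: \<mu>_def algebra_simps)
      then show ?thesis by (simp add: power_mult_distrib)
    qed
    moreover have "2 * (\<epsilon> * q * p ^ d / real d)\<^sup>2 * N = 2 * (\<epsilon> * p ^ d)\<^sup>2 * (q\<^sup>2 * N / (real d)\<^sup>2)"
      by (simp add: power_mult_distrib power_divide)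
    moreover have "2 * (\<epsilon> * q * p ^ d / real d)\<^sup>2 * real n \<le> 2 * (\<epsilon> * q * p ^ d / real d)\<^sup>2 * N"
      using nN by (intro mult_left_mono) auto
    ultimately show ?thesis by linarith
  qed
  let ?bad = "{g. facet_count (included g) \<le> \<mu> - \<epsilon> * \<mu>}"
  have "measure_pmf.prob (bern p) ?bad \<le> exp (- (2 * (\<epsilon> * \<mu>)\<^sup>2 / C))"
    unfolding E[symmetric]
    using sum_difference_bounds \<epsilon> \<mu>0 C0 E
    by (intro McDiarmid_lower_tail[where c = "\<lambda>x. real d + vertex_weight x"] fin_vertices facet_count_bounded_difference)
      (auto simp: C_def N_def m_def)
  also have "\<dots> \<le> exp (- 2 * (\<epsilon> * q * p ^ d / real d)\<^sup>2 * real n)"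
    using exponent by simp
  finally have "1 - exp (- 2 * (\<epsilon> * q * p ^ d / real d)\<^sup>2 * real n) \<le> 1 - measure_pmf.prob (bern p) ?bad" by simp
  also have "\<dots> = measure_pmf.prob (bern p) (- ?bad)"
    using measure_pmf.prob_compl[of ?bad "bern p"] by (simp add: Compl_eq_Diff_UNIV)
  also have "\<dots> \<le> measure_pmf.prob (bern p) {g. (1 - \<epsilon>) * ?\<mu>n \<le> real (card (facets (convex hull (included g))))}"
  proof (rule measure_pmf.finite_measure_mono)
    show "- ?bad \<subseteq> {g. (1 - \<epsilon>) * ?\<mu>n \<le> real (card (facets (convex hull (included g))))}"
    proof
      fix g assume "g \<in> - ?bad"
      then have "(1 - \<epsilon>) * \<mu> \<le> facet_count (included g)" by (simp add: algebra_simps)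
      also have "\<dots> \<le> real (card (facets (convex hull (included g))))"
        by (rule facet_count_le_card_facets) auto
      finally show "g \<in> {g. (1 - \<epsilon>) * ?\<mu>n \<le> real (card (facets (convex hull (included g))))}"
        using \<mu>n by simp
    qed
  qed simp
  finally show ?thesis
    by (simp add: random_subpolytope_conv_bern q_def vimage_def)
qed

end

theorem theorem6:
  fixes P :: "'a::euclidean_space set" and d m n :: nat and p q :: real
  assumes "simple_d_polytope d P"
    and "d \<ge> 2"
    and "card (facets P) = m"
    and "card (vertices P) \<ge> n"
    and "0 \<le> p" and "p \<le> 1"
    and "q = 1 - p"
  shows "measure_pmf.expectation (random_subpolytope P p) (\<lambda>Q. real (card (facets Q)))
           \<ge> p ^ d * real m + real n * q * p ^ d
       \<and> (\<forall>\<epsilon>::real. \<epsilon> > 0 \<longrightarrow>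
           measure_pmf.prob (random_subpolytope P p)
             {Q. real (card (facets Q)) \<ge> (1 - \<epsilon>) * (p ^ d * real m + real n * q * p ^ d)}
           \<ge> 1 - exp (- 2 * (\<epsilon> * q * p ^ d / real d)\<^sup>2 * real n)
               - exp (- (real m * p ^ d * \<epsilon>\<^sup>2 / 2)))"
proof -
  interpret simple_polytope P d by unfold_locales (use assms in auto)
  show ?thesis
  proof (intro conjI allI impI)
    show "measure_pmf.expectation (random_subpolytope P p) (\<lambda>Q. real (card (facets Q)))
           \<ge> p ^ d * real m + real n * q * p ^ d"
      using expected_facets_ge[of p n] assms by simp
    fix \<epsilon> :: real assume "\<epsilon> > 0"
    then have "1 - exp (- 2 * (\<epsilon> * q * p ^ d / real d)\<^sup>2 * real n) \<le> measure_pmf.prob (random_subpolytope P p)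
             {Q. real (card (facets Q)) \<ge> (1 - \<epsilon>) * (p ^ d * real m + real n * q * p ^ d)}"
      using facets_lower_tail[of p n \<epsilon>] assms by simp
    \<comment> \<open>The single-exponential bound is the stronger one: subtracting a further
      positive term only lowers the right-hand side.\<close>
    moreover have "0 < exp (- (real m * p ^ d * \<epsilon>\<^sup>2 / 2))" by simp
    ultimately show "measure_pmf.prob (random_subpolytope P p)
             {Q. real (card (facets Q)) \<ge> (1 - \<epsilon>) * (p ^ d * real m + real n * q * p ^ d)}
           \<ge> 1 - exp (- 2 * (\<epsilon> * q * p ^ d / real d)\<^sup>2 * real n)
               - exp (- (real m * p ^ d * \<epsilon>\<^sup>2 / 2))" by linarith
  qed
qed

end
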